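(* Let $N\ge 1$, let $\mu_1,\dots,\mu_N$ be non-zero real numbers, $\alpha>0$, $\nu>0$, and $\delta^{(\nu)}_1,\dots,\delta^{(\nu)}_N>0$. Let $W^{(\alpha,\nu)}_\mu$ be the associated matrix weight on $(0,\infty)$ and $\{P_n^{(\alpha,\nu)}\}_{n\ge 0}$ its monic matrix valued orthogonal polynomials. Let $D^{(\alpha,\nu)}$ be the second-order matrix differential operator, acting from the right on matrix valued $C^2([0,\infty))$-functions $Q$ by $$(QD^{(\alpha,\nu)})(x)=\frac{d^2Q}{dx^2}(x)\,F_2^{(\alpha,\nu)}(x)+\frac{dQ}{dx}(x)\,F_1^{(\alpha,\nu)}(x)+Q(x)\,F_0^{(\alpha,\nu)}(x),$$ where $F_2^{(\alpha,\nu)}(x)=x$ (times the identity) and $$F_1^{(\alpha,\nu)}(x)=-x(A_\mu+1)^{-1}+\nu+J+1+(\alpha+J)A_\mu,\qquad F_0^{(\alpha,\nu)}(x)=(\alpha-\nu)(A_\mu+1)^{-1}-J.$$ Then $D^{(\alpha,\nu)}$ is symmetric with respect to $W^{(\alpha,\nu)}_\mu$. Moreover, for all $n\in\mathbb{N}=\{0,1,2,\dots\}$, $$P_n^{(\alpha,\nu)}D^{(\alpha,\nu)}=\Gamma_n^{(\alpha,\nu)}P_n^{(\alpha,\nu)},\qquad \Gamma_n^{(\alpha,\nu)}=(-n+\alpha-\nu)(A_\mu+1)^{-1}-J.$$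
   Context: The Laguerre polynomials $L_n^{(a)}(x)$ are defined by $(1-t)^{-1-a}\exp\left(\frac{xt}{t-1}\right)=\sum_{n\ge0}L_n^{(a)}(x)t^n$. $L^{(\alpha)}_\mu(x)$ is the $N\times N$ unipotent lower triangular matrix polynomial with $L^{(\alpha)}_\mu(x)_{m,n}=\frac{\mu_m}{\mu_n}L^{(\alpha+n)}_{m-n}(x)$ for $m\ge n$ and $0$ for $m<n$. $A_\mu$ is the $N\times N$ matrix whose only non-zero entries are $(A_\mu)_{k,k-1}=-\mu_k/\mu_{k-1}$, $2\le k\le N$; $J=\mathrm{diag}(1,2,\dots,N)$. Scalars in matrix expressions denote multiples of the identity matrix. The weight is $W^{(\alpha,\nu)}_\mu(x)=L^{(\alpha)}_\mu(x)T^{(\nu)}(x)L^{(\alpha)}_\mu(x)^\ast$, $x>0$, where $T^{(\nu)}(x)$ is the diagonal matrix with $T^{(\nu)}(x)_{k,k}=e^{-x}x^{\nu+k}\delta^{(\nu)}_k$. The monic orthogonal polynomials $P_n^{(\alpha,\nu)}\in M_N(\mathbb{C})[x]$ have degree $n$, leading coefficient the identity, and satisfy $\int_0^\infty P_n^{(\alpha,\nu)}(x)W^{(\alpha,\nu)}_\mu(x)P_m^{(\alpha,\nu)}(x)^\ast dx=0$ for $n\ne m$. A second-order matrix differential operator $D$ acting from the right is symmetric with respect to a positive definite matrix weight $W$ on $(0,\infty)$ with finite moments of all orders if $\int_0^\infty (GD)(x)W(x)H(x)^\ast dx=\int_0^\infty G(x)W(x)\bigl((HD)(x)\bigr)^\ast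 dx$ for all matrix valued $C^2([0,\infty))$-functions $G,H$.
   Formalization: Symmetry is proved for C² pairs G,H for which both integrals converge absolutely and |G||W||H|, |G'||W||H|, |G||W||H'| are integrable; for all C² pairs it is false (N=1, α=ν+1, G=1, H zero near 0 with H'=e^x x^(-ν-2) for large x). *)

theory Defs
  imports
    "HOL-Analysis.Analysis"
    "HOL-Computational_Algebra.Formal_Power_Series"
begin

text \<open>
  An \<open>N \<times> N\<close> complex matrix is an element of \<open>'n cmat\<close>, with \<open>'n\<close> a finite
  linearly ordered type and \<open>N = CARD('n)\<close>.  The position of \<open>i\<close> in \<open>'n\<close> is its rank, so that
  \<open>idx\<close> is the order isomorphism from \<open>'n\<close> onto \<open>{1..N}\<close>.
\<close>

type_synonym 'n cmat = "((complex, 'n) vec, 'n) vec"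

definition idx :: "'n::{finite,linorder} \<Rightarrow> nat" where
  "idx i = card {..i}"

definition mat_adjoint :: "'n::finite cmat \<Rightarrow> 'n cmat" where
  "mat_adjoint M = map_matrix cnj (transpose M)"


section \<open>The matrix weight\<close>

text \<open>Coefficient of \<open>t\<^sup>n\<close> in \<open>(1 - t) powr (-1 - a) * exp (x * t / (t - 1))\<close>, as formal power series in \<open>t\<close>;
  \<open>fps_binomial c\<close> is the series of \<open>(1 + t) powr c\<close>.\<close>

definition laguerre :: "nat \<Rightarrow> real \<Rightarrow> real \<Rightarrow> real" where
  "laguerre n a x =
     fps_nth ((fps_binomial (- 1 - a) oo (- fps_X)) * (fps_exp x oo (fps_X / (fps_X - 1)))) n"

definition Lmat :: "real \<Rightarrow> ('n::{finite,linorder} \<Rightarrow> real) \<Rightarrow> real \<Rightarrow> 'n cmat" where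
  "Lmat \<alpha> \<mu> x = (\<chi> m n. if n \<le> m
     then of_real (\<mu> m / \<mu> n * laguerre (idx m - idx n) (\<alpha> + real (idx n)) x) else 0)"

definition Tmat :: "real \<Rightarrow> ('n::{finite,linorder} \<Rightarrow> real) \<Rightarrow> real \<Rightarrow> 'n cmat" where
  "Tmat \<nu> \<delta> x = (\<chi> k j. if k = j
     then of_real (exp (- x) * x powr (\<nu> + real (idx k)) * \<delta> k) else 0)"

definition weight :: "real \<Rightarrow> real \<Rightarrow> ('n::{finite,linorder} \<Rightarrow> real) \<Rightarrow> ('n \<Rightarrow> real) \<Rightarrow> real \<Rightarrow> 'n cmat" where
  "weight \<alpha> \<nu> \<mu> \<delta> x = Lmat \<alpha> \<mu> x ** Tmat \<nu> \<delta> x ** mat_adjoint (Lmat \<alpha> \<mu> x)"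


section \<open>Monic matrix valued orthogonal polynomials on the positive half-line\<close>

definition monic_matpoly :: "nat \<Rightarrow> (real \<Rightarrow> 'n::finite cmat) \<Rightarrow> bool" where
  "monic_matpoly n p \<longleftrightarrow> (\<exists>C. C n = mat 1 \<and> (\<forall>x. p x = (\<Sum>k\<le>n. x ^ k *\<^sub>R C k)))"

definition monic_MVOPs :: "(real \<Rightarrow> 'n::finite cmat) \<Rightarrow> (nat \<Rightarrow> real \<Rightarrow> 'n cmat) \<Rightarrow> bool" where
  "monic_MVOPs W P \<longleftrightarrow>
     (\<forall>n. monic_matpoly n (P n)) \<and>
     (\<forall>n m. n \<noteq> m \<longrightarrow> (LINT x:{0<..}|lborel. P n x ** W x ** mat_adjoint (P m x)) = 0)"


section \<open>Second-order differential operators acting from the right\<close>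

text \<open>The derivative on \<open>[0,\<infinity>)\<close>, one-sided at \<open>0\<close>; only its values at \<open>x \<ge> 0\<close> are meaningful.\<close>

definition deriv0 :: "(real \<Rightarrow> 'n::finite cmat) \<Rightarrow> real \<Rightarrow> 'n cmat" where
  "deriv0 Q x = vector_derivative Q (at x within {0..})"

definition C2 :: "(real \<Rightarrow> 'n::finite cmat) \<Rightarrow> bool" where
  "C2 Q \<longleftrightarrow> Q differentiable_on {0..} \<and> deriv0 Q differentiable_on {0..} \<and>
     continuous_on {0..} (deriv0 (deriv0 Q))"

definition diffop ::
  "(real \<Rightarrow> 'n::finite cmat) \<Rightarrow> (real \<Rightarrow> 'n cmat) \<Rightarrow> (real \<Rightarrow> 'n cmat) \<Rightarrow>
   (real \<Rightarrow> 'n cmat) \<Rightarrow> real \<Rightarrow> 'n cmat" where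
  "diffop F2 F1 F0 Q x = deriv0 (deriv0 Q) x ** F2 x + deriv0 Q x ** F1 x + Q x ** F0 x"

text \<open>
  The pairs \<open>G, H\<close> for which the symmetry identity is required: both integrals in it converge
  absolutely, and so do those of the products \<open>G W H\<close>, \<open>G' W H\<close>, \<open>G W H'\<close> (in norm).  The
  last three conditions exclude boundary contributions at infinity.  They cannot be dropped: for
  \<open>W(x) = exp(-x) x powr a\<close> and \<open>Q D = x Q'' + (a + 1 - x) Q'\<close> with \<open>a > 0\<close>, take \<open>G = 1\<close> and a smooth
  \<open>H\<close> vanishing near \<open>0\<close> with \<open>H'(x) = exp x * x powr (- a - 1)\<close> for large \<open>x\<close>.  Then \<open>G D = 0\<close>
  everywhere and \<open>H D = 0\<close> for large \<open>x\<close>, yet the integral of \<open>G W (H D)\<close> is \<open>1\<close>.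
  If \<open>W\<close> has finite moments of all orders and the coefficients are polynomials, all
  polynomially bounded \<open>G, H\<close> with polynomially bounded derivatives up to order two are covered.
\<close>

definition admissible_pair ::
  "(real \<Rightarrow> 'n::finite cmat) \<Rightarrow> ((real \<Rightarrow> 'n cmat) \<Rightarrow> real \<Rightarrow> 'n cmat) \<Rightarrow>
   (real \<Rightarrow> 'n cmat) \<Rightarrow> (real \<Rightarrow> 'n cmat) \<Rightarrow> bool" where
  "admissible_pair W D G H \<longleftrightarrow>
     set_integrable lborel {0<..} (\<lambda>x. D G x ** W x ** mat_adjoint (H x)) \<and>
     set_integrable lborel {0<..} (\<lambda>x. G x ** W x ** mat_adjoint (D H x)) \<and>
     set_integrable lborel {0<..} (\<lambda>x. norm (G x) * norm (W x) * norm (H x)) \<and>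
     set_integrable lborel {0<..} (\<lambda>x. norm (deriv0 G x) * norm (W x) * norm (H x)) \<and>
     set_integrable lborel {0<..} (\<lambda>x. norm (G x) * norm (W x) * norm (deriv0 H x))"

definition symmetric_wrt ::
  "(real \<Rightarrow> 'n::finite cmat) \<Rightarrow> ((real \<Rightarrow> 'n cmat) \<Rightarrow> real \<Rightarrow> 'n cmat) \<Rightarrow> bool" where
  "symmetric_wrt W D \<longleftrightarrow> (\<forall>G H. C2 G \<longrightarrow> C2 H \<longrightarrow> admissible_pair W D G H \<longrightarrow>
     (LINT x:{0<..}|lborel. D G x ** W x ** mat_adjoint (H x)) =
     (LINT x:{0<..}|lborel. G x ** W x ** mat_adjoint (D H x)))"


section \<open>The operator and its eigenvalues\<close>

definition Amat :: "('n::{finite,linorder} \<Rightarrow> real) \<Rightarrow> 'n cmat" where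
  "Amat \<mu> = (\<chi> k j. if idx k = idx j + 1 then of_real (- \<mu> k / \<mu> j) else 0)"

definition Jmat :: "'n::{finite,linorder} cmat" where
  "Jmat = (\<chi> k j. if k = j then of_nat (idx k) else 0)"

definition smat :: "real \<Rightarrow> 'n::finite cmat" where
  "smat c = mat (of_real c)"

definition F2 :: "real \<Rightarrow> 'n::finite cmat" where
  "F2 x = smat x"

definition F1 :: "real \<Rightarrow> real \<Rightarrow> ('n::{finite,linorder} \<Rightarrow> real) \<Rightarrow> real \<Rightarrow> 'n cmat" where
  "F1 \<alpha> \<nu> \<mu> x = - (x *\<^sub>R matrix_inv (Amat \<mu> + smat 1)) + smat \<nu> + Jmat + smat 1
     + (smat \<alpha> + Jmat) ** Amat \<mu>"

definition F0 :: "real \<Rightarrow> real \<Rightarrow> ('n::{finite,linorder} \<Rightarrow> real) \<Rightarrow> real \<Rightarrow> 'n cmat" where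
  "F0 \<alpha> \<nu> \<mu> x = (\<alpha> - \<nu>) *\<^sub>R matrix_inv (Amat \<mu> + smat 1) - Jmat"

definition Dop :: "real \<Rightarrow> real \<Rightarrow> ('n::{finite,linorder} \<Rightarrow> real) \<Rightarrow>
   (real \<Rightarrow> 'n cmat) \<Rightarrow> real \<Rightarrow> 'n cmat" where
  "Dop \<alpha> \<nu> \<mu> = diffop F2 (F1 \<alpha> \<nu> \<mu>) (F0 \<alpha> \<nu> \<mu>)"

definition Gam :: "real \<Rightarrow> real \<Rightarrow> ('n::{finite,linorder} \<Rightarrow> real) \<Rightarrow> nat \<Rightarrow> 'n cmat" where
  "Gam \<alpha> \<nu> \<mu> n = (- real n + \<alpha> - \<nu>) *\<^sub>R matrix_inv (Amat \<mu> + smat 1) - Jmat"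

end

theory Submission
  imports Defs
begin

text \<open>
  Write \<open>L = Lmat\<close>, \<open>T = Tmat\<close>, \<open>A = Amat\<close>.  The recurrences of the Laguerre polynomials give
  \<open>L' = L A\<close> and \<open>(A + 1) L (1 - A) = L\<close>, and they show that under the substitution \<open>R = Q L\<close> the
  operator becomes diagonal: \<open>(Q D) L = x R'' + R' (\<nu> + 1 + J - x) + R (\<alpha> - \<nu> - J)\<close>, which is
  formally symmetric for \<open>T\<close> since \<open>(x T)' = (\<nu> + 1 + J - x) T\<close>.  Hence with \<open>S = H L\<close> the
  difference of the two integrands in the symmetry identity for \<open>G, H\<close> is the derivative of
  \<open>B = x (R' T S\<^sup>* - R T S'\<^sup>*)\<close>.  As \<open>L A = Z L\<close> with the constant matrix \<open>Z = 1 - (A + 1)\<^sup>-\<^sup>1\<close>,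
  \<open>B / x\<close> is dominated by the integrable functions of an admissible pair; \<open>B\<close> has a limit at
  infinity, which must be \<open>0\<close> because \<open>1 / x\<close> is not integrable there.

  For the eigenvalue equation, \<open>P\<^sub>n D - \<Gamma>\<^sub>n P\<^sub>n\<close> has degree less than \<open>n\<close>, and by symmetry it is
  orthogonal to every polynomial of degree less than \<open>n\<close>, in particular to itself.
\<close>

section \<open>Laguerre polynomials\<close>

text \<open>The series of (1 - t) powr c. Every factor of the generating function is reduced to
  powers of this form, so that additivity in the exponent replaces division.\<close>

abbreviation binom_neg :: "real \<Rightarrow> real fps" where
  "binom_neg c \<equiv> fps_binomial c oo (- fps_X)"

abbreviation lag_arg :: "real fps" where
  "lag_arg \<equiv> fps_X / (fps_X - 1)"

text \<open>The whole generating function as one series in t with x as a parameter: relations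
  between polynomials of different degree become single identities between series.\<close>

definition laguerre_gf :: "real \<Rightarrow> real \<Rightarrow> real fps" where
  "laguerre_gf a x = binom_neg (- 1 - a) * (fps_exp x oo lag_arg)"

lemma laguerre_eq_gf: "laguerre n a x = fps_nth (laguerre_gf a x) n"
  by (simp add: laguerre_def laguerre_gf_def)

lemma binom_neg_add: "binom_neg (c + d) = binom_neg c * binom_neg d"
  by (simp add: fps_binomial_add_mult fps_compose_mult_distrib)

lemma binom_neg_1: "binom_neg 1 = 1 - fps_X"
  by (simp add: fps_binomial_1 fps_compose_add_distrib)

text \<open>The quotient by \<open>1 + fps_X\<close> in the derivative is absorbed by lowering the
  exponent by one.\<close>

lemma fps_binomial_deriv_shift: "fps_deriv (fps_binomial c) = fps_const c * fps_binomial (c - 1)"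
  for c :: "'a::field_char_0"
proof -
  have "fps_binomial c = fps_binomial (c - 1) * (1 + fps_X)"
    using fps_binomial_add_mult[of "c - 1" 1] by (simp add: fps_binomial_1)
  then have "fps_const c * fps_binomial c / (1 + fps_X)
      = (fps_const c * fps_binomial (c - 1)) * (1 + fps_X) / (1 + fps_X)"
    by (simp add: mult.assoc)
  also have "\<dots> = fps_const c * fps_binomial (c - 1)"
    by (rule nonzero_mult_div_cancel_right) (metis fps_X_nth fps_add_nth fps_one_nth fps_zero_nth add_0_right one_neq_zero zero_neq_one)
  finally show ?thesis by (simp add: fps_binomial_deriv)
qed

lemma binom_neg_deriv: "fps_deriv (binom_neg c) = - (fps_const c * binom_neg (c - 1))"
  by (simp add: fps_compose_deriv fps_binomial_deriv_shift fps_compose_mult_distrib)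

lemma binom_neg_minus_1: "(1 - fps_X) * binom_neg (- 1) = 1"
  using binom_neg_add[of 1 "-1"] by (simp add: binom_neg_1)

lemma lag_arg_eq: "lag_arg = - fps_X * binom_neg (- 1)"
proof -
  have "(- fps_X * binom_neg (- 1)) * (fps_X - 1) = fps_X * ((1 - fps_X) * binom_neg (- 1))"
    by (simp add: algebra_simps)
  then have "fps_X = (- fps_X * binom_neg (- 1)) * (fps_X - 1)"
    by (simp only: binom_neg_minus_1 mult_1_right)
  then have "lag_arg = (- fps_X * binom_neg (- 1)) * (fps_X - 1) / (fps_X - 1)"
    by metis
  also have "\<dots> = - fps_X * binom_neg (- 1)"
    by (rule nonzero_mult_div_cancel_right) (metis eq_iff_diff_eq_0 fps_X_neq_one)
  finally show ?thesis .
qed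

text \<open>Since t / (t - 1) = 1 - 1 / (1 - t), the derivative comes from the binomial series
  alone.\<close>

lemma lag_arg_deriv: "fps_deriv lag_arg = - binom_neg (- 2)"
proof -
  have "lag_arg = 1 - binom_neg (- 1)"
    using binom_neg_minus_1 by (simp add: lag_arg_eq algebra_simps)
  then show ?thesis by (simp add: binom_neg_deriv flip: fps_const_neg)
qed

lemma lag_arg_nth_0 [simp]: "fps_nth lag_arg 0 = 0"
  by (simp add: lag_arg_eq)

text \<open>The parameter a enters only through the factor (1 - t) powr (-1 - a), so a unit step in
  a is multiplication by a power of 1 - t.\<close>

lemma laguerre_gf_lower: "laguerre_gf (a - 1) x = (1 - fps_X) * laguerre_gf a x"
  using binom_neg_add[of 1 "-1 - a"] by (simp add: laguerre_gf_def binom_neg_1 mult.assoc)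

lemma laguerre_gf_raise: "binom_neg (- 1) * laguerre_gf a x = laguerre_gf (a + 1) x"
proof -
  have "- 1 - (a + 1) = - 1 + (- 1 - a)"
    by simp
  then show ?thesis
    by (simp only: laguerre_gf_def binom_neg_add mult.assoc)
qed

text \<open>Product rule in t: the power factor contributes (1 + a) / (1 - t) and the exponential
  factor -x / (1 - t)^2, and these powers of 1 - t raise the parameter by 1 and by 2.\<close>

lemma laguerre_gf_deriv:
  "fps_deriv (laguerre_gf a x) =
     fps_const (1 + a) * laguerre_gf (a + 1) x - fps_const x * laguerre_gf (a + 2) x"
proof -
  have "binom_neg (- 1 - a) * binom_neg (- 2) = binom_neg (- 1 - (a + 2))"
    using binom_neg_add[of "-1 - a" "-2"] by (simp add: algebra_simps)
  then have *: "binom_neg (- 1 - a) * (z * (y * binom_neg (- 2))) = z * (y * binom_neg (- 1 - (a + 2)))"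
    for y z :: "real fps" by (simp add: mult_ac)
  have "fps_deriv (fps_exp x oo lag_arg) = - (fps_const x * (fps_exp x oo lag_arg) * binom_neg (- 2))"
    by (subst fps_compose_deriv) (simp_all add: fps_compose_mult_distrib lag_arg_deriv)
  moreover have "fps_deriv (binom_neg (- 1 - a)) = fps_const (1 + a) * binom_neg (- 1 - (a + 1))"
    by (simp add: binom_neg_deriv flip: mult_minus_left)
  ultimately show ?thesis
    by (simp add: laguerre_gf_def * mult.assoc)
qed

section \<open>Recurrences of the Laguerre polynomials and their derivative in x\<close>

lemma laguerre_lower: "laguerre (Suc n) (a - 1) x = laguerre (Suc n) a x - laguerre n a x"
  by (simp add: laguerre_eq_gf laguerre_gf_lower algebra_simps)

lemma laguerre_0 [simp]: "laguerre 0 a x = 1"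
  by (simp add: laguerre_def)

lemma laguerre_rec:
  "real (Suc n) * laguerre (Suc n) a x = (1 + a) * laguerre n (a + 1) x - x * laguerre n (a + 2) x"
  using arg_cong[OF laguerre_gf_deriv, of "\<lambda>f. fps_nth f n" a x]
  by (simp add: laguerre_eq_gf)

text \<open>For fixed n the coefficient is a finite sum of powers of x, so it is differentiated term
  by term; the result is the coefficient of \<open>(fps_X * fps_exp x) oo u\<close>.\<close>

lemma fps_exp_compose_deriv:
  fixes u :: "real fps"
  assumes [simp]: "fps_nth u 0 = 0"
  shows "((\<lambda>x. fps_nth (fps_exp x oo u) n) has_real_derivative fps_nth (u * (fps_exp x oo u)) n) (at x)"
proof -
  have "u * (fps_exp x oo u) = (fps_X * fps_exp x) oo u"
    by (simp add: fps_compose_mult_distrib)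
  also have "fps_nth \<dots> n = (\<Sum>j = 0..n. real j * x ^ (j - 1) / fact j * fps_nth (u ^ j) n)"
    unfolding fps_compose_nth
  proof (intro sum.cong refl)
    fix j show "fps_nth (fps_X * fps_exp x) j * fps_nth (u ^ j) n
        = real j * x ^ (j - 1) / fact j * fps_nth (u ^ j) n"
      by (cases j) (simp_all del: of_nat_Suc power_Suc)
  qed
  finally show ?thesis
    unfolding fps_compose_nth by (auto intro!: derivative_eq_intros sum.cong simp: field_simps)
qed

text \<open>Differentiating in x multiplies the generating function by t / (t - 1) = -t (1 -
  t)^(-1): the parameter goes up by one and the degree down by one.\<close>

lemma laguerre_has_real_derivative:
  "((\<lambda>x. laguerre n a x) has_real_derivative - fps_nth (fps_X * laguerre_gf (a + 1) x) n) (at x)"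
proof -
  have "- (fps_X * laguerre_gf (a + 1) x) = lag_arg * laguerre_gf a x"
    by (simp add: lag_arg_eq mult.assoc laguerre_gf_raise)
  also have "\<dots> = binom_neg (- 1 - a) * (lag_arg * (fps_exp x oo lag_arg))"
    by (simp add: laguerre_gf_def mult_ac)
  finally have "- fps_nth (fps_X * laguerre_gf (a + 1) x) n
      = fps_nth (binom_neg (- 1 - a) * (lag_arg * (fps_exp x oo lag_arg))) n"
    by (metis fps_neg_nth)
  also have "\<dots> = (\<Sum>i = 0..n. fps_nth (binom_neg (- 1 - a)) i * fps_nth (lag_arg * (fps_exp x oo lag_arg)) (n - i))"
    by (rule fps_mult_nth)
  finally show ?thesis
    unfolding laguerre_eq_gf laguerre_gf_def
    by (subst (1) fps_mult_nth) (auto intro!: derivative_eq_intros fps_exp_compose_deriv sum.cong)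
qed

text \<open>With the convention that it vanishes for negative degree, the Laguerre polynomial satisfies its
  recurrences for every integer degree, so no boundary cases arise in the matrix identities.\<close>

definition lag :: "int \<Rightarrow> real \<Rightarrow> real \<Rightarrow> real" where
  "lag k a x = (if k < 0 then 0 else laguerre (nat k) a x)"

lemma lag_neg [simp]: "k < 0 \<Longrightarrow> lag k a x = 0"
  by (simp add: lag_def)

lemma lag_0 [simp]: "lag 0 a x = 1"
  by (simp add: lag_def)

text \<open>The split matches recurrences that pass from degree n to n + 1; k = 0 stands apart
  because k - 1 is then negative.\<close>

lemma int_sign_cases:
  obtains "k < 0" | "k = 0" | n where "k = 1 + int n"
  by (metis linorder_cases zero_less_imp_eq_int of_nat_Suc gr0_implies_Suc of_nat_0_less_iff)

lemma lag_lower: "lag k (a - 1) x = lag k a x - lag (k - 1) a x"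
  by (cases k rule: int_sign_cases) (simp_all add: lag_def nat_add_distrib laguerre_lower)

lemma lag_rec: "of_int k * lag k a x = (1 + a) * lag (k - 1) (a + 1) x - x * lag (k - 1) (a + 2) x"
  using laguerre_rec[of _ a x]
  by (cases k rule: int_sign_cases) (simp_all add: lag_def nat_add_distrib algebra_simps)

lemma lag_deriv:
  "((\<lambda>x. lag k a x) has_real_derivative - lag (k - 1) (a + 1) x) (at x)"
proof (cases k rule: int_sign_cases)
  case (3 n)
  then show ?thesis
    using laguerre_has_real_derivative[of "Suc n" a x]
    by (simp add: lag_def nat_add_distrib flip: laguerre_eq_gf)
qed (simp_all add: lag_def)

text \<open>Laguerre's differential equation x y'' + (a + 1 - x) y' + k y = 0, with y' and y''
  written as polynomials of lower degree and raised parameter.\<close>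

lemma lag_ode:
  "of_int k * lag k a x = (a + 1 - x) * lag (k - 1) (a + 1) x - x * lag (k - 2) (a + 2) x"
proof -
  have "lag (k - 1) (a + 2) x = lag (k - 1) (a + 1) x + lag (k - 2) (a + 2) x"
    using lag_lower[of "k - 1" "a + 2" x] by (simp add: add.commute)
  then show ?thesis
    by (simp add: lag_rec algebra_simps)
qed

text \<open>The classical formula x y' = k y - (k + a) z, where y and z have degrees k and k - 1 and
  the same parameter a; it is \<open>lag_rec\<close> with a lowered by one.\<close>

lemma lag_diff:
  "(of_int k + a) * lag (k - 1) a x = of_int k * lag k a x + x * lag (k - 1) (a + 1) x"
  using lag_rec[of k "a - 1" x] by (simp add: lag_lower algebra_simps)

section \<open>Conjugation of the coefficients by \<open>Lmat\<close>\<close>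

lemma bounded_bilinear_matrix_mult: "bounded_bilinear ((**) :: 'n::finite cmat \<Rightarrow> 'n cmat \<Rightarrow> 'n cmat)"
  unfolding bilinear_conv_bounded_bilinear[symmetric] bilinear_def
  by (auto intro!: linearI simp: matrix_matrix_mult_def vec_eq_iff algebra_simps sum.distrib scaleR_sum_right)

lemmas matrix_mult_algebra =
  bounded_bilinear.add_left[OF bounded_bilinear_matrix_mult]
  bounded_bilinear.add_right[OF bounded_bilinear_matrix_mult]
  bounded_bilinear.diff_left[OF bounded_bilinear_matrix_mult]
  bounded_bilinear.diff_right[OF bounded_bilinear_matrix_mult]
  bounded_bilinear.minus_left[OF bounded_bilinear_matrix_mult]
  bounded_bilinear.minus_right[OF bounded_bilinear_matrix_mult]
  bounded_bilinear.scaleR_left[OF bounded_bilinear_matrix_mult]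
  bounded_bilinear.scaleR_right[OF bounded_bilinear_matrix_mult]
  bounded_bilinear.zero_left[OF bounded_bilinear_matrix_mult]
  bounded_bilinear.zero_right[OF bounded_bilinear_matrix_mult]

text \<open>A vector is the finite sum of its embedded entries; derivatives and growth bounds
  therefore pass from the entries to the vector, and applied twice to matrices.\<close>

lemma bounded_linear_axis: "bounded_linear (\<lambda>z::'a::euclidean_space. axis i z)"
  unfolding linear_conv_bounded_linear[symmetric]
  by (auto intro!: linearI simp: axis_def vec_eq_iff)

lemma sum_axis: "(\<Sum>i\<in>UNIV. axis i (v $ i)) = v"
  by (simp add: vec_eq_iff axis_def if_distrib[of "\<lambda>v. v $ _"] cong: if_cong)

lemma has_vector_derivative_vec:
  fixes f :: "real \<Rightarrow> 'a::euclidean_space ^ 'n::finite"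
  assumes "\<And>i. ((\<lambda>x. f x $ i) has_vector_derivative f' $ i) F"
  shows "(f has_vector_derivative f') F"
proof -
  have "((\<lambda>x. \<Sum>i\<in>UNIV. axis i (f x $ i)) has_vector_derivative (\<Sum>i\<in>UNIV. axis i (f' $ i))) F"
    by (intro has_vector_derivative_sum bounded_linear.has_vector_derivative[OF bounded_linear_axis] assms)
  then show ?thesis
    by (simp only: sum_axis)
qed

section \<open>Ranks of indices, and matrices given by formulas in the ranks\<close>

lemma idx_le_iff: "idx m \<le> idx n \<longleftrightarrow> m \<le> n" for m n :: "'n::{finite,linorder}"
proof
  show "m \<le> n \<Longrightarrow> idx m \<le> idx n"
    unfolding idx_def by (intro card_mono) auto
next
  assume "idx m \<le> idx n"
  moreover have "idx n < idx m" if "n < m"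
    unfolding idx_def using that by (intro psubset_card_mono) (auto intro!: psubsetI dest: order.antisym)
  ultimately show "m \<le> n"
    by (metis not_le)
qed

lemma idx_eq_iff: "idx m = idx n \<longleftrightarrow> m = n" for m n :: "'n::{finite,linorder}"
  by (metis idx_le_iff order.antisym order.refl)

text \<open>Supplies the neighbours of an index, which shifts by A require. An injection of the N
  indices into {1..N} is onto.\<close>

lemma idx_surj:
  assumes "1 \<le> i" "i \<le> CARD('n::{finite,linorder})"
  obtains k :: "'n::{finite,linorder}" where "idx k = i"
proof -
  have "range (idx :: 'n \<Rightarrow> nat) \<subseteq> {1..CARD('n)}"
    by (auto simp: idx_def Suc_le_eq card_gt_0_iff card_mono)
  moreover have "card (range (idx :: 'n \<Rightarrow> nat)) = card {1..CARD('n)}"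
    by (subst card_image) (auto simp: inj_on_def idx_eq_iff)
  ultimately have "range (idx :: 'n \<Rightarrow> nat) = {1..CARD('n)}"
    by (intro card_subset_eq) auto
  with assms that show ?thesis
    by (metis atLeastAtMost_iff imageE)
qed

lemma idx_bounds: "1 \<le> idx k" "idx k \<le> CARD('n)" for k :: "'n::{finite,linorder}"
  by (auto simp: idx_def Suc_le_eq card_gt_0_iff card_mono)

text \<open>The matrix of f conjugated by the diagonal matrix of \<mu>. The arguments of f are
  integers, so that f can also be evaluated at row 0 and column N + 1, just outside the
  matrix.\<close>

definition mu_mat :: "('n::{finite,linorder} \<Rightarrow> real) \<Rightarrow> (int \<Rightarrow> int \<Rightarrow> real) \<Rightarrow> 'n cmat" where
  "mu_mat \<mu> f = (\<chi> m n. of_real (\<mu> m / \<mu> n * f (int (idx m)) (int (idx n))))"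

lemma mu_mat_add: "mu_mat \<mu> f + mu_mat \<mu> g = mu_mat \<mu> (\<lambda>i j. f i j + g i j)"
  by (simp add: mu_mat_def vec_eq_iff algebra_simps add_divide_distrib)

lemma mu_mat_diff: "mu_mat \<mu> f - mu_mat \<mu> g = mu_mat \<mu> (\<lambda>i j. f i j - g i j)"
  by (simp add: mu_mat_def vec_eq_iff algebra_simps diff_divide_distrib)

lemma mu_mat_minus: "- mu_mat \<mu> f = mu_mat \<mu> (\<lambda>i j. - f i j)"
  by (simp add: mu_mat_def vec_eq_iff)

lemma mu_mat_scaleR: "c *\<^sub>R mu_mat \<mu> f = mu_mat \<mu> (\<lambda>i j. c * f i j)"
  unfolding vec_eq_iff mu_mat_def
  by (simp only: vector_scaleR_component vec_lambda_beta) (simp add: scaleR_conv_of_real)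

lemmas mu_mat_linear = mu_mat_add mu_mat_diff mu_mat_minus mu_mat_scaleR

definition diag_mat :: "('n::finite \<Rightarrow> real) \<Rightarrow> 'n cmat" where
  "diag_mat d = (\<chi> k j. if k = j then of_real (d k) else 0)"

lemma diag_mat_mult_left: "(diag_mat d ** X) $ i $ j = of_real (d i) * X $ i $ j"
  by (simp add: matrix_matrix_mult_def diag_mat_def if_distrib[of "\<lambda>x. x * _"] cong: if_cong)

lemma diag_mat_mult_right: "(X ** diag_mat d) $ i $ j = X $ i $ j * of_real (d j)"
  by (simp add: matrix_matrix_mult_def diag_mat_def if_distrib cong: if_cong)

lemma diag_mat_add: "diag_mat d + diag_mat e = diag_mat (\<lambda>k. d k + e k)"
  by (simp add: diag_mat_def vec_eq_iff)

lemma Jmat_eq: "Jmat = diag_mat (\<lambda>k. real (idx k))"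
  by (simp add: Jmat_def diag_mat_def vec_eq_iff)

lemma smat_eq: "smat c = diag_mat (\<lambda>_. c)"
  by (simp add: smat_def mat_def diag_mat_def vec_eq_iff)

lemma smat_1: "smat 1 = mat 1"
  by (simp add: smat_def)

lemma Tmat_eq: "Tmat \<nu> \<delta> x = diag_mat (\<lambda>k. exp (- x) * x powr (\<nu> + real (idx k)) * \<delta> k)"
  by (simp add: Tmat_def diag_mat_def)

text \<open>The triangular shape needs no case distinction here, because \<open>lag\<close> vanishes
  in negative degree.\<close>

lemma Lmat_eq: "Lmat \<alpha> \<mu> x = mu_mat \<mu> (\<lambda>i j. lag (i - j) (\<alpha> + of_int j) x)"
  unfolding Lmat_def mu_mat_def vec_eq_iff
  by (auto simp: idx_le_iff[symmetric] lag_def nat_diff_distrib)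

lemma diag_mult_mu_mat:
  assumes "\<And>k. d k = g (int (idx k))"
  shows "diag_mat d ** mu_mat \<mu> f = mu_mat \<mu> (\<lambda>i j. g i * f i j)"
  by (simp add: vec_eq_iff diag_mat_mult_left mu_mat_def assms)

lemma mu_mat_mult_diag:
  assumes "\<And>k. d k = g (int (idx k))"
  shows "mu_mat \<mu> f ** diag_mat d = mu_mat \<mu> (\<lambda>i j. f i j * g j)"
  by (simp add: vec_eq_iff diag_mat_mult_right mu_mat_def assms)

context
  fixes \<mu> :: "'n::{finite,linorder} \<Rightarrow> real"
  assumes \<mu>_nz: "\<And>k. \<mu> k \<noteq> 0"
begin

text \<open>Up to conjugation by \<mu>, A is minus the shift along the subdiagonal, so left
  multiplication moves the row index by one.\<close>

lemma Amat_mult_mu_mat: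
  assumes "\<And>i j. i < j \<Longrightarrow> f i j = 0"
  shows "Amat \<mu> ** mu_mat \<mu> f = mu_mat \<mu> (\<lambda>i j. - f (i - 1) j)"
proof -
  have "(\<Sum>k\<in>UNIV. Amat \<mu> $ m $ k * mu_mat \<mu> f $ k $ n) = mu_mat \<mu> (\<lambda>i j. - f (i - 1) j) $ m $ n" for m n
  proof (cases "idx m = 1")
    case True
    \<comment> \<open>The first row of A is zero, and on the right f is evaluated in row 0, which
      lies above the diagonal.\<close>
    then have "int (idx m) - 1 < int (idx n)"
      using idx_bounds(1)[of n] by simp
    moreover have "Amat \<mu> $ m $ k = 0" for k
      using True idx_bounds(1)[of k] by (simp add: Amat_def)
    ultimately show ?thesis
      by (simp add: mu_mat_def assms)
  next
    case False
    then obtain p :: 'n where p: "idx p = idx m - 1"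
      using idx_bounds[of m] by (metis One_nat_def Suc_leI diff_le_self idx_surj le_neq_implies_less le_trans zero_less_diff)
    then have pm: "idx m = idx p + 1"
      using idx_bounds(1)[of m] by simp
    have "Amat \<mu> $ m $ k = (if k = p then of_real (- \<mu> m / \<mu> p) else 0)" for k
      using pm by (auto simp: Amat_def idx_eq_iff)
    then have "(\<Sum>k\<in>UNIV. Amat \<mu> $ m $ k * mu_mat \<mu> f $ k $ n)
        = of_real (- \<mu> m / \<mu> p) * mu_mat \<mu> f $ p $ n"
      by (simp add: if_distrib[of "\<lambda>x. x * _"] cong: if_cong)
    also have "\<dots> = mu_mat \<mu> (\<lambda>i j. - f (i - 1) j) $ m $ n"
      using pm \<mu>_nz by (simp add: mu_mat_def)
    finally show ?thesis .
  qed
  then show ?thesis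
    by (simp add: vec_eq_iff matrix_matrix_mult_def)
qed

lemma mu_mat_mult_Amat:
  assumes "\<And>i j. i < j \<Longrightarrow> f i j = 0"
  shows "mu_mat \<mu> f ** Amat \<mu> = mu_mat \<mu> (\<lambda>i j. - f i (j + 1))"
proof -
  have "(\<Sum>k\<in>UNIV. mu_mat \<mu> f $ m $ k * Amat \<mu> $ k $ n) = mu_mat \<mu> (\<lambda>i j. - f i (j + 1)) $ m $ n" for m n
  proof (cases "idx n = CARD('n)")
    case True
    \<comment> \<open>The mirror case: the last column of A is zero, and column N + 1 lies above the
      diagonal.\<close>
    then have "int (idx m) < int (idx n) + 1"
      using idx_bounds(2)[of m] by simp
    moreover have "Amat \<mu> $ k $ n = 0" for k
      using True idx_bounds(2)[of k] by (simp add: Amat_def)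
    ultimately show ?thesis
      by (simp add: mu_mat_def assms)
  next
    case False
    then obtain p :: 'n where p: "idx p = idx n + 1"
      using idx_bounds[of n] by (metis Suc_eq_plus1 Suc_leI idx_surj le_add2 le_neq_implies_less)
    have A: "Amat \<mu> $ k $ n = (if k = p then of_real (- \<mu> p / \<mu> n) else 0)" for k
      using p idx_eq_iff[of k p] by (auto simp: Amat_def)
    have "(\<Sum>k\<in>UNIV. mu_mat \<mu> f $ m $ k * Amat \<mu> $ k $ n)
        = mu_mat \<mu> f $ m $ p * of_real (- \<mu> p / \<mu> n)"
      by (simp add: A if_distrib cong: if_cong)
    also have "\<dots> = mu_mat \<mu> (\<lambda>i j. - f i (j + 1)) $ m $ n"
      using p \<mu>_nz by (simp add: mu_mat_def add.commute)
    finally show ?thesis .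
  qed
  then show ?thesis
    by (simp add: vec_eq_iff matrix_matrix_mult_def)
qed

lemma Amat_plus_1_mult_mu_mat:
  assumes "\<And>i j. i < j \<Longrightarrow> f i j = 0"
  shows "(Amat \<mu> + smat 1) ** mu_mat \<mu> f = mu_mat \<mu> (\<lambda>i j. f i j - f (i - 1) j)"
  using assms by (simp add: matrix_mult_algebra Amat_mult_mu_mat smat_1 mu_mat_add)

lemma mu_mat_delta: "mu_mat \<mu> (\<lambda>i j. if i = j then 1 else 0) = mat 1"
  using \<mu>_nz by (auto simp: mu_mat_def mat_def vec_eq_iff idx_eq_iff)

text \<open>A + 1 takes backward differences in the row index. Its inverse is therefore summation,
  the matrix \<open>?f\<close> with ones on and below the diagonal.\<close>

lemma matrix_inv_Amat: "matrix_inv (Amat \<mu> + smat 1) ** (Amat \<mu> + smat 1) = mat 1"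
proof -
  let ?f = "\<lambda>i j. if j \<le> i then 1 else 0 :: real"
  have "(Amat \<mu> + smat 1) ** mu_mat \<mu> ?f = mu_mat \<mu> (\<lambda>i j. ?f i j - ?f (i - 1) j)"
    by (rule Amat_plus_1_mult_mu_mat) simp
  also have "\<dots> = mu_mat \<mu> (\<lambda>i j. if i = j then 1 else 0)"
    by (intro arg_cong[where f = "mu_mat \<mu>"] ext) auto
  finally have "(Amat \<mu> + smat 1) ** mu_mat \<mu> ?f = mat 1"
    by (simp only: mu_mat_delta)
  then have "invertible (Amat \<mu> + smat 1)"
    unfolding invertible_def using matrix_left_right_inverse by blast
  then show ?thesis
    unfolding matrix_inv_def invertible_def by (metis (mono_tags, lifting) someI_ex)
qed

lemma matrix_inv_Amat_mult_mu_mat: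
  assumes "\<And>i j. i < j \<Longrightarrow> f i j = 0"
  shows "matrix_inv (Amat \<mu> + smat 1) ** mu_mat \<mu> (\<lambda>i j. f i j - f (i - 1) j) = mu_mat \<mu> f"
proof -
  have "mu_mat \<mu> f = matrix_inv (Amat \<mu> + smat 1) ** ((Amat \<mu> + smat 1) ** mu_mat \<mu> f)"
    by (simp add: matrix_mul_assoc matrix_inv_Amat)
  then show ?thesis
    using assms by (simp add: Amat_plus_1_mult_mu_mat)
qed

section \<open>Moving A and its relatives past L\<close>

lemma Lmat_mult_Amat:
  "Lmat \<alpha> \<mu> x ** Amat \<mu> = mu_mat \<mu> (\<lambda>i j. - lag (i - j - 1) (\<alpha> + of_int j + 1) x)"
  by (simp add: Lmat_eq mu_mat_mult_Amat algebra_simps)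

lemma Lmat_mult_Amat_Amat:
  "Lmat \<alpha> \<mu> x ** Amat \<mu> ** Amat \<mu> = mu_mat \<mu> (\<lambda>i j. lag (i - j - 2) (\<alpha> + of_int j + 2) x)"
  by (simp add: Lmat_mult_Amat mu_mat_mult_Amat algebra_simps)

text \<open>By \<open>lag_lower\<close>, L is the backward difference of the same array with
  parameter raised by one; the inverse of A + 1 undoes this difference.\<close>

lemma matrix_inv_Amat_mult_Lmat_eq:
  "matrix_inv (Amat \<mu> + smat 1) ** Lmat \<alpha> \<mu> x = mu_mat \<mu> (\<lambda>i j. lag (i - j) (\<alpha> + of_int j + 1) x)"
proof -
  let ?f = "\<lambda>i j. lag (i - j) (\<alpha> + of_int j + 1) x"
  have "Lmat \<alpha> \<mu> x = mu_mat \<mu> (\<lambda>i j. ?f i j - ?f (i - 1) j)"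
    unfolding Lmat_eq
  proof (intro arg_cong[where f = "mu_mat \<mu>"] ext)
    show "lag (i - j) (\<alpha> + of_int j) x = ?f i j - ?f (i - 1) j" for i j
      using lag_lower[of "i - j" "\<alpha> + of_int j + 1" x] by (simp add: algebra_simps)
  qed
  then show ?thesis
    using matrix_inv_Amat_mult_mu_mat[of ?f] by simp
qed

text \<open>Lowering the raised parameter again splits each entry in two; the part of lower degree
  is an entry of -L A.\<close>

lemma matrix_inv_Amat_mult_Lmat:
  "matrix_inv (Amat \<mu> + smat 1) ** Lmat \<alpha> \<mu> x = Lmat \<alpha> \<mu> x - Lmat \<alpha> \<mu> x ** Amat \<mu>"
  using lag_lower[of _ "\<alpha> + of_int _ + 1" x]
  by (simp add: matrix_inv_Amat_mult_Lmat_eq Lmat_mult_Amat)  (simp add: Lmat_eq mu_mat_diff)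

lemma lag_raise: "lag (i - j) (\<alpha> + of_int j + 1) x
    = lag (i - j) (\<alpha> + of_int j) x + lag (i - j - 1) (\<alpha> + of_int j + 1) x"
  using lag_lower[of "i - j" "\<alpha> + of_int j + 1" x] by simp

text \<open>Compares the coefficients of Q' under R = Q L: 2 x L A comes from x R'', the diagonal
  part from R'. Entrywise it reduces to \<open>lag_diff\<close>.\<close>

lemma F1_mult_Lmat:
  "F1 \<alpha> \<nu> \<mu> x ** Lmat \<alpha> \<mu> x = (2 * x) *\<^sub>R (Lmat \<alpha> \<mu> x ** Amat \<mu>)
     + Lmat \<alpha> \<mu> x ** diag_mat (\<lambda>k. \<nu> + 1 + real (idx k) - x)"
proof -
  let ?L = "Lmat \<alpha> \<mu> x"
  let ?l = "\<lambda>i j. lag (i - j) (\<alpha> + of_int j) x"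
  have "F1 \<alpha> \<nu> \<mu> x ** ?L = - (x *\<^sub>R (matrix_inv (Amat \<mu> + smat 1) ** ?L))
      + diag_mat (\<lambda>k. \<nu> + 1 + real (idx k)) ** ?L + diag_mat (\<lambda>k. \<alpha> + real (idx k)) ** (Amat \<mu> ** ?L)"
  proof -
    have "F1 \<alpha> \<nu> \<mu> x = - (x *\<^sub>R matrix_inv (Amat \<mu> + smat 1)) + diag_mat (\<lambda>k. \<nu> + 1 + real (idx k))
        + diag_mat (\<lambda>k. \<alpha> + real (idx k)) ** Amat \<mu>"
      unfolding F1_def Jmat_eq smat_eq by (simp add: diag_mat_add add.assoc add_ac)
    then show ?thesis
      by (simp add: matrix_mult_algebra matrix_mul_assoc)
  qed
  also have "\<dots> = mu_mat \<mu> (\<lambda>i j. - (x * lag (i - j) (\<alpha> + of_int j + 1) x)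
      + (\<nu> + 1 + of_int i) * ?l i j + (\<alpha> + of_int i) * - ?l (i - 1) j)"
    by (simp add: matrix_inv_Amat_mult_Lmat_eq)
       (simp add: Lmat_eq Amat_mult_mu_mat mu_mat_linear
         diag_mult_mu_mat[where g = "\<lambda>i. \<nu> + 1 + of_int i"] diag_mult_mu_mat[where g = "\<lambda>i. \<alpha> + of_int i"])
  also have "\<dots> = mu_mat \<mu> (\<lambda>i j. 2 * x * - lag (i - j - 1) (\<alpha> + of_int j + 1) x
      + ?l i j * (\<nu> + 1 + of_int j - x))"
  proof (intro arg_cong[where f = "mu_mat \<mu>"] ext)
    fix i j
    show "- (x * lag (i - j) (\<alpha> + of_int j + 1) x)
        + (\<nu> + 1 + of_int i) * ?l i j + (\<alpha> + of_int i) * - ?l (i - 1) j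
      = 2 * x * - lag (i - j - 1) (\<alpha> + of_int j + 1) x + ?l i j * (\<nu> + 1 + of_int j - x)"
      using lag_diff[of "i - j" "\<alpha> + of_int j" x] unfolding lag_raise by (simp add: algebra_simps)
  qed
  also have "\<dots> = (2 * x) *\<^sub>R (?L ** Amat \<mu>) + ?L ** diag_mat (\<lambda>k. \<nu> + 1 + real (idx k) - x)"
    by (simp add: Lmat_mult_Amat)
       (simp add: Lmat_eq mu_mat_linear mu_mat_mult_diag[where g = "\<lambda>i. \<nu> + 1 + of_int i - x"])
  finally show ?thesis .
qed

text \<open>Compares the coefficients of Q under R = Q L, with L A = L' and L A A = L''. Entrywise
  it is Laguerre's differential equation.\<close>

lemma F0_mult_Lmat:
  "F0 \<alpha> \<nu> \<mu> x ** Lmat \<alpha> \<mu> x = x *\<^sub>R (Lmat \<alpha> \<mu> x ** Amat \<mu> ** Amat \<mu>)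
     + Lmat \<alpha> \<mu> x ** Amat \<mu> ** diag_mat (\<lambda>k. \<nu> + 1 + real (idx k) - x)
     + Lmat \<alpha> \<mu> x ** diag_mat (\<lambda>k. \<alpha> - \<nu> - real (idx k))"
proof -
  let ?L = "Lmat \<alpha> \<mu> x"
  let ?l = "\<lambda>i j. lag (i - j) (\<alpha> + of_int j) x"
  have "F0 \<alpha> \<nu> \<mu> x ** ?L = (\<alpha> - \<nu>) *\<^sub>R (matrix_inv (Amat \<mu> + smat 1) ** ?L)
      - diag_mat (\<lambda>k. real (idx k)) ** ?L"
    by (simp add: F0_def Jmat_eq matrix_mult_algebra)
  also have "\<dots> = mu_mat \<mu> (\<lambda>i j. (\<alpha> - \<nu>) * lag (i - j) (\<alpha> + of_int j + 1) x - of_int i * ?l i j)"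
    by (simp add: matrix_inv_Amat_mult_Lmat_eq)
       (simp add: Lmat_eq mu_mat_linear diag_mult_mu_mat[where g = "\<lambda>i. of_int i"])
  also have "\<dots> = mu_mat \<mu> (\<lambda>i j. x * lag (i - j - 2) (\<alpha> + of_int j + 2) x
      + - lag (i - j - 1) (\<alpha> + of_int j + 1) x * (\<nu> + 1 + of_int j - x)
      + ?l i j * (\<alpha> - \<nu> - of_int j))"
  proof (intro arg_cong[where f = "mu_mat \<mu>"] ext)
    fix i j
    show "(\<alpha> - \<nu>) * lag (i - j) (\<alpha> + of_int j + 1) x - of_int i * ?l i j
      = x * lag (i - j - 2) (\<alpha> + of_int j + 2) x
      + - lag (i - j - 1) (\<alpha> + of_int j + 1) x * (\<nu> + 1 + of_int j - x)
      + ?l i j * (\<alpha> - \<nu> - of_int j)"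
      using lag_ode[of "i - j" "\<alpha> + of_int j" x] unfolding lag_raise by (simp add: algebra_simps)
  qed
  also have "\<dots> = x *\<^sub>R (?L ** Amat \<mu> ** Amat \<mu>)
     + ?L ** Amat \<mu> ** diag_mat (\<lambda>k. \<nu> + 1 + real (idx k) - x)
     + ?L ** diag_mat (\<lambda>k. \<alpha> - \<nu> - real (idx k))"
    by (simp add: Lmat_mult_Amat_Amat)
       (simp add: Lmat_mult_Amat, simp add: Lmat_eq mu_mat_linear
         mu_mat_mult_diag[where g = "\<lambda>i. \<nu> + 1 + of_int i - x"]
         mu_mat_mult_diag[where g = "\<lambda>i. \<alpha> - \<nu> - of_int i"])
  finally show ?thesis .
qed

lemma Lmat_has_vector_derivative:
  "(Lmat \<alpha> \<mu> has_vector_derivative Lmat \<alpha> \<mu> x ** Amat \<mu>) (at x)"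
proof -
  have "((\<lambda>x. Lmat \<alpha> \<mu> x $ i $ j) has_vector_derivative (Lmat \<alpha> \<mu> x ** Amat \<mu>) $ i $ j) (at x)" for i j
  proof -
    let ?k = "int (idx i) - int (idx j)" and ?a = "\<alpha> + real (idx j)"
    have "((\<lambda>x. \<mu> i / \<mu> j * lag ?k ?a x) has_real_derivative \<mu> i / \<mu> j * - lag (?k - 1) (?a + 1) x) (at x)"
      by (intro DERIV_cmult lag_deriv)
    then have "((\<lambda>x. of_real (\<mu> i / \<mu> j * lag ?k ?a x)) has_vector_derivative
        complex_of_real (\<mu> i / \<mu> j * - lag (?k - 1) (?a + 1) x)) (at x)"
      by (intro has_vector_derivative_of_real) (simp add: has_real_derivative_iff_has_vector_derivative)
    then show ?thesis
      by (simp only: Lmat_mult_Amat) (simp add: Lmat_eq mu_mat_def)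
  qed
  then show ?thesis
    by (intro has_vector_derivative_vec)
qed

end

section \<open>Integrals over the positive half-line\<close>

text \<open>Beyond some X the function dominates c / x, whose integral up to y grows like c ln
  y.\<close>

lemma not_integrable_inverse_near_infinity:
  fixes g :: "real \<Rightarrow> real"
  assumes "set_integrable lborel {0<..} g" "c > 0"
    and "eventually (\<lambda>x. c \<le> x * g x) at_top"
  shows False
proof -
  obtain X0 where "\<And>x. x \<ge> X0 \<Longrightarrow> c \<le> x * g x"
    using assms(3) by (auto simp: eventually_at_top_linorder)
  define X where "X = max X0 1"
  have X: "X \<ge> 1" "\<And>x. x \<ge> X \<Longrightarrow> c \<le> x * g x"
    using \<open>\<And>x. x \<ge> X0 \<Longrightarrow> c \<le> x * g x\<close> by (auto simp: X_def)
  have int: "set_integrable lborel {X..} g"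
    using assms(1) by (rule set_integrable_subset) (use X in auto)
  have gX: "g x \<ge> c / x" if "x \<ge> X" for x
    using X(2)[OF that] X(1) that by (simp add: divide_le_eq mult.commute)
  have "c * (ln y - ln X) \<le> (LINT x:{X..}|lborel. g x)" if "y \<ge> X" for y
  proof -
    have "(LINT x:{X..y}|lborel. c / x) = c * ln y - c * ln X"
      unfolding set_lebesgue_integral_def
    proof (rule integral_FTC_Icc)
      fix x assume "X \<le> x" "x \<le> y"
      then show "((\<lambda>x. c * ln x) has_vector_derivative c / x) (at x within {X..y})"
        using X(1) by (auto intro!: derivative_eq_intros simp flip: has_real_derivative_iff_has_vector_derivative)
    qed (use X(1) that in \<open>auto intro!: continuous_intros\<close>)
    moreover have "(LINT x:{X..y}|lborel. c / x) \<le> (LINT x:{X..y}|lborel. g x)"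
    proof (rule set_integral_mono)
      show "set_integrable lborel {X..y} (\<lambda>x. c / x)"
        using X(1) by (intro borel_integrable_atLeastAtMost') (auto intro!: continuous_intros)
      show "set_integrable lborel {X..y} g"
        using int by (rule set_integrable_subset) auto
    qed (use gX in auto)
    moreover have "(LINT x:{X..y}|lborel. g x) \<le> (LINT x:{X..}|lborel. g x)"
      unfolding set_lebesgue_integral_def
    proof (rule integral_mono)
      show "integrable lborel (\<lambda>x. indicat_real {X..y} x *\<^sub>R g x)"
        using set_integrable_subset[OF int, of "{X..y}"] by (simp add: set_integrable_def)
      show "integrable lborel (\<lambda>x. indicat_real {X..} x *\<^sub>R g x)"
        using int by (simp add: set_integrable_def)
      show "indicat_real {X..y} x *\<^sub>R g x \<le> indicat_real {X..} x *\<^sub>R g x" for x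
        using gX[of x] X(1) \<open>c > 0\<close> by (auto simp: indicator_def intro: order_trans[of 0 "c / x"])
    qed
    ultimately show ?thesis
      by (simp add: algebra_simps)
  qed
  \<comment> \<open>This y makes c (ln y - ln X) exceed the absolute value of the total integral by
    exactly 1.\<close>
  from this[of "X * exp ((\<bar>LINT x:{X..}|lborel. g x\<bar> + 1) / c)"] show False
    using X(1) \<open>c > 0\<close> by (simp add: ln_mult)
qed

text \<open>Fundamental theorem on the half-line. The boundary term at infinity is not assumed to
  vanish: integrability of f gives it a limit, and integrability of g forces that limit to be
  0.\<close>

lemma integral_derivative_eq_0:
  fixes B f :: "real \<Rightarrow> 'a::euclidean_space"
  assumes deriv: "\<And>x. x > 0 \<Longrightarrow> (B has_vector_derivative f x) (at x)"
    and cont: "continuous_on {0<..} f"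
    and int: "set_integrable lborel {0<..} f"
    and g: "set_integrable lborel {0<..} g" "\<And>x. x > 0 \<Longrightarrow> norm (B x) \<le> x * g x"
    and zero: "(B \<longlongrightarrow> 0) (at_right 0)"
  shows "(LINT x:{0<..}|lborel. f x) = 0"
proof -
  have int1: "set_integrable lborel {1..} f"
    using int by (rule set_integrable_subset) auto
  \<comment> \<open>By the fundamental theorem on [1, y], this is the limit of B at
    infinity.\<close>
  define c where "c = B 1 + (LINT x:{1..}|lborel. f x)"
  have "((\<lambda>y. B 1 + (LINT x:{1..y}|lborel. f x)) \<longlongrightarrow> c) at_top"
    unfolding c_def by (intro tendsto_add tendsto_const tendsto_set_lebesgue_integral_at_top int1) auto
  moreover have "eventually (\<lambda>y. B 1 + (LINT x:{1..y}|lborel. f x) = B y) at_top"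
    using eventually_ge_at_top[of 1]
  proof eventually_elim
    case (elim y)
    have "(LINT x:{1..y}|lborel. f x) = B y - B 1"
      unfolding set_lebesgue_integral_def using elim
      by (intro integral_FTC_Icc)
        (auto intro: continuous_on_subset[OF cont] intro!: deriv[THEN has_vector_derivative_at_within])
    then show ?case by simp
  qed
  ultimately have lim: "(B \<longlongrightarrow> c) at_top"
    by (rule Lim_transform_eventually)
  have "c = 0"
  proof (rule ccontr)
    assume "c \<noteq> 0"
    have "eventually (\<lambda>x. norm c / 2 < norm (B x)) at_top"
      using tendsto_norm[OF lim] \<open>c \<noteq> 0\<close> by (intro order_tendstoD) auto
    then have "eventually (\<lambda>x. norm c / 2 \<le> x * g x) at_top"
      using eventually_gt_at_top[of 0]
    proof eventually_elim
      case (elim x)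
      show ?case
        using elim(1) g(2)[OF elim(2)] by linarith
    qed
    then show False
      using \<open>c \<noteq> 0\<close> by (intro not_integrable_inverse_near_infinity[OF g(1), of "norm c / 2"]) simp_all
  qed
  have "(LBINT x=0..\<infinity>. f x) = 0 - 0"
  proof (rule interval_integral_FTC_integrable)
    show "((B \<circ> real_of_ereal) \<longlongrightarrow> 0) (at_right 0)"
      unfolding zero_ereal_def using zero by (simp add: ereal_tendsto_simps)
    show "((B \<circ> real_of_ereal) \<longlongrightarrow> 0) (at_left \<infinity>)"
      using lim \<open>c = 0\<close> by (simp add: ereal_tendsto_simps)
    show "set_integrable lborel (einterval 0 \<infinity>) f"
      using int by (simp add: zero_ereal_def)
    show "isCont f x" if "0 < ereal x" for x
      using cont that by (simp add: continuous_on_eq_continuous_at)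
  qed (auto simp: deriv)
  then show ?thesis
    by (simp add: interval_integral_to_infinity_eq zero_ereal_def)
qed

lemma nonneg_set_integral_0_imp_0:
  fixes h :: "real \<Rightarrow> real"
  assumes cont: "continuous_on {0<..} h" and nn: "\<And>x. x > 0 \<Longrightarrow> h x \<ge> 0"
    and int: "set_integrable lborel {0<..} h" and zero: "(LINT x:{0<..}|lborel. h x) = 0"
    and x: "x > 0"
  shows "h x = 0"
proof -
  have "AE y in lborel. indicat_real {0<..} y *\<^sub>R h y = 0"
    using int zero nn unfolding set_integrable_def set_lebesgue_integral_def
    by (subst integral_nonneg_eq_0_iff_AE[symmetric]) (auto simp: indicator_def)
  \<comment> \<open>A compact interval ending in x and inside the open half-line, where continuity
    upgrades vanishing almost everywhere to vanishing everywhere.\<close>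
  then have "AE y in lborel. y \<in> {x/2..x} \<longrightarrow> h y = 0"
    by eventually_elim (use x in \<open>auto simp: indicator_def\<close>)
  then have "(LINT y:{x/2..x}|lborel. h y) = 0"
    unfolding set_lebesgue_integral_def by (intro integral_eq_zero_AE) (auto simp: indicator_def)
  moreover have "continuous_on {x/2..x} h"
    using cont by (rule continuous_on_subset) (use x in auto)
  then have "(h has_integral (LINT y:{x/2..x}|lborel. h y)) {x/2..x}"
    by (metis borel_integrable_atLeastAtMost' set_borel_integral_eq_integral integrable_integral)
  ultimately have "(h has_integral 0) (cbox (x/2) x)"
    by simp
  then show ?thesis
    using \<open>continuous_on {x/2..x} h\<close> nn x
    by (intro has_integral_0_cbox_imp_0[of "x/2" x h]) auto
qed

text \<open>At most polynomial growth on the open half-line. With base 1 + x instead of x, powers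
  increase with the exponent also for x < 1, so bounds with different exponents can be
  added.\<close>

definition poly_bounded :: "(real \<Rightarrow> 'a::real_normed_vector) \<Rightarrow> bool" where
  "poly_bounded f \<longleftrightarrow> (\<exists>C K. \<forall>x>0. norm (f x) \<le> C * (1 + x) ^ K)"

lemma poly_boundedI:
  assumes "\<And>x. x > 0 \<Longrightarrow> norm (f x) \<le> C * (1 + x) ^ K"
  shows "poly_bounded f"
  using assms by (auto simp: poly_bounded_def)

lemma poly_boundedE:
  assumes "poly_bounded f"
  obtains C K where "C \<ge> 0" "\<And>x. x > 0 \<Longrightarrow> norm (f x) \<le> C * (1 + x) ^ K"
proof -
  obtain C K where CK: "\<And>x. x > 0 \<Longrightarrow> norm (f x) \<le> C * (1 + x) ^ K"
    using assms by (auto simp: poly_bounded_def)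
  have "0 \<le> C * (1 + 1) ^ K"
    by (rule order_trans[OF norm_ge_zero CK[of 1]]) simp
  then have "C \<ge> 0"
    using mult_right_le_imp_le[of 0 "(1 + 1) ^ K" C] by simp
  then show thesis
    using CK by (rule that)
qed

lemma poly_bounded_const: "poly_bounded (\<lambda>_. c)"
  by (rule poly_boundedI[of _ "norm c" 0]) simp

lemma poly_bounded_ident: "poly_bounded (\<lambda>x. x)"
  by (rule poly_boundedI[of _ 1 1]) simp

lemma poly_bounded_bilinear:
  assumes "bounded_bilinear h" "poly_bounded f" "poly_bounded g"
  shows "poly_bounded (\<lambda>x. h (f x) (g x))"
proof -
  obtain B where B: "B > 0" "\<And>a b. norm (h a b) \<le> norm a * norm b * B"
    using bounded_bilinear.pos_bounded[OF assms(1)] by auto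
  obtain C K where f: "C \<ge> 0" "\<And>x. x > 0 \<Longrightarrow> norm (f x) \<le> C * (1 + x) ^ K"
    by (rule poly_boundedE[OF assms(2)]) (rule that)
  obtain C' K' where g: "C' \<ge> 0" "\<And>x. x > 0 \<Longrightarrow> norm (g x) \<le> C' * (1 + x) ^ K'"
    by (rule poly_boundedE[OF assms(3)]) (rule that)
  show ?thesis
  proof (rule poly_boundedI[of _ "C * C' * B" "K + K'"])
    fix x :: real assume "x > 0"
    have "norm (h (f x) (g x)) \<le> norm (f x) * norm (g x) * B"
      by (rule B)
    also have "\<dots> \<le> (C * (1 + x) ^ K) * (C' * (1 + x) ^ K') * B"
      using B(1) f g \<open>x > 0\<close> by (intro mult_right_mono mult_mono) auto
    finally show "norm (h (f x) (g x)) \<le> C * C' * B * (1 + x) ^ (K + K')"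
      by (simp add: power_add mult_ac)
  qed
qed

lemma poly_bounded_linear:
  assumes "bounded_linear h" "poly_bounded f"
  shows "poly_bounded (\<lambda>x. h (f x))"
proof -
  obtain B where B: "B > 0" "\<And>a. norm (h a) \<le> norm a * B"
    using bounded_linear.pos_bounded[OF assms(1)] by blast
  obtain C K where f: "\<And>x. x > 0 \<Longrightarrow> norm (f x) \<le> C * (1 + x) ^ K"
    using assms(2) by (auto simp: poly_bounded_def)
  have "norm (h (f x)) \<le> (B * C) * (1 + x) ^ K" if "x > 0" for x
    using order_trans[OF B(2) mult_right_mono[OF f[OF that]]] B(1) by (simp add: mult_ac)
  then show ?thesis
    by (rule poly_boundedI)
qed

lemma poly_bounded_norm: "poly_bounded f \<Longrightarrow> poly_bounded (\<lambda>x. norm (f x))"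
  by (simp add: poly_bounded_def)

lemma poly_bounded_add:
  assumes "poly_bounded f" "poly_bounded g"
  shows "poly_bounded (\<lambda>x. f x + g x)"
proof -
  obtain C K where f: "C \<ge> 0" "\<And>x. x > 0 \<Longrightarrow> norm (f x) \<le> C * (1 + x) ^ K"
    by (rule poly_boundedE[OF assms(1)]) (rule that)
  obtain C' K' where g: "C' \<ge> 0" "\<And>x. x > 0 \<Longrightarrow> norm (g x) \<le> C' * (1 + x) ^ K'"
    by (rule poly_boundedE[OF assms(2)]) (rule that)
  show ?thesis
  proof (rule poly_boundedI[of _ "C + C'" "K + K'" ])
    fix x :: real assume "x > 0"
    have "norm (f x + g x) \<le> C * (1 + x) ^ K + C' * (1 + x) ^ K'"
      by (intro norm_triangle_le add_mono f(2) g(2) \<open>x > 0\<close>)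
    also have "\<dots> \<le> C * (1 + x) ^ (K + K') + C' * (1 + x) ^ (K + K')"
      using f(1) g(1) \<open>x > 0\<close> by (intro add_mono mult_left_mono power_increasing) auto
    finally show "norm (f x + g x) \<le> (C + C') * (1 + x) ^ (K + K')"
      by (simp add: algebra_simps)
  qed
qed

lemma poly_bounded_sum:
  assumes "\<And>i. i \<in> A \<Longrightarrow> poly_bounded (f i)"
  shows "poly_bounded (\<lambda>x. \<Sum>i\<in>A. f i x)"
  using assms by (induction A rule: infinite_finite_induct) (simp_all add: poly_bounded_const poly_bounded_add)

lemma poly_bounded_power: "poly_bounded f \<Longrightarrow> poly_bounded (\<lambda>x. f x ^ n :: real)"
  by (induction n) (simp_all add: poly_bounded_const poly_bounded_bilinear[OF bounded_bilinear_mult])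

lemma poly_bounded_powr:
  assumes "a \<ge> 0"
  shows "poly_bounded (\<lambda>x. x powr a)"
proof (rule poly_boundedI[of _ 1 "nat \<lceil>a\<rceil>"])
  fix x :: real assume "x > 0"
  have "x powr a \<le> (1 + x) powr a"
    using \<open>x > 0\<close> assms by (intro powr_mono2) auto
  also have "\<dots> \<le> (1 + x) powr real (nat \<lceil>a\<rceil>)"
    using \<open>x > 0\<close> assms by (intro powr_mono) linarith+
  also have "\<dots> = (1 + x) ^ nat \<lceil>a\<rceil>"
    using \<open>x > 0\<close> by (subst powr_realpow) auto
  finally show "norm (x powr a) \<le> 1 * (1 + x) ^ nat \<lceil>a\<rceil>"
    by simp
qed

lemma power_le_fact_exp:
  fixes y :: real
  assumes "y \<ge> 0"
  shows "y ^ n \<le> fact n * exp y"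
proof -
  have "(\<Sum>k\<in>{n}. y ^ k /\<^sub>R fact k) \<le> (\<Sum>k. y ^ k /\<^sub>R fact k)"
    using assms by (intro sum_le_suminf summable_exp_generic) simp_all
  then have "y ^ n / fact n \<le> exp y"
    by (simp add: exp_def divide_inverse mult.commute)
  then show ?thesis
    by (simp add: divide_le_eq mult.commute)
qed

text \<open>Half of the exponential decay absorbs the polynomial factor; the other half, exp (-x/2),
  is integrable.\<close>

lemma set_integrable_exp_times_poly_bounded:
  fixes f :: "real \<Rightarrow> 'a::euclidean_space"
  assumes "poly_bounded f" "continuous_on {0<..} f"
  shows "set_integrable lborel {0<..} (\<lambda>x. exp (- x) *\<^sub>R f x)"
proof -
  obtain C K where f: "C \<ge> 0" "\<And>x. x > 0 \<Longrightarrow> norm (f x) \<le> C * (1 + x) ^ K"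
    by (rule poly_boundedE[OF assms(1)]) (rule that)
  \<comment> \<open>From ((1 + x) / 2)^K <= K! exp ((1 + x) / 2), a single term of the exponential
    series; the power of 2 undoes the halving and exp (1/2) is the constant part of the
    exponent.\<close>
  define c where "c = C * (2 ^ K * fact K * exp (1/2))"
  have "(\<lambda>x::real. exp (- (1/2) * x)) absolutely_integrable_on {0..}"
    by (rule nonnegative_absolutely_integrable_1, rule integrable_on_exp_minus_to_infinity) simp_all
  \<comment> \<open>Absolute integrability refers to the completed measure; Borel measurability
    carries it back to \<open>lborel\<close>.\<close>
  moreover have "(\<lambda>x::real. indicat_real {0..} x *\<^sub>R exp (- (1/2) * x)) \<in> borel_measurable lborel"
    unfolding measurable_lborel2
    by (intro borel_measurable_continuous_on_indicator continuous_intros) simp_all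
  ultimately have "set_integrable lborel {0..} (\<lambda>x. exp (- (1/2) * x) :: real)"
    unfolding set_integrable_def by (simp only: integrable_completion)
  then have "set_integrable lborel {0<..} (\<lambda>x. exp (- (1/2) * x) :: real)"
    by (rule set_integrable_subset) auto
  then have int: "set_integrable lborel {0<..} (\<lambda>x. c * exp (- (1/2) * x))"
    by (rule set_integrable_mult_right)
  have bound: "norm (exp (- x) *\<^sub>R f x) \<le> c * exp (- (1/2) * x)" if "x > 0" for x
  proof -
    have "(1 + x) ^ K = 2 ^ K * ((1 + x) / 2) ^ K"
      by (simp add: power_divide)
    also have "\<dots> \<le> 2 ^ K * (fact K * exp ((1 + x) / 2))"
      using that by (intro mult_left_mono power_le_fact_exp) simp_all
    finally have "(1 + x) ^ K \<le> 2 ^ K * fact K * exp ((1 + x) / 2)"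
      by (simp only: mult.assoc)
    then have "norm (f x) \<le> C * (2 ^ K * fact K * exp ((1 + x) / 2))"
      using f(1) by (intro order_trans[OF f(2)[OF that]] mult_left_mono)
    then have "exp (- x) * norm (f x) \<le> exp (- x) * (C * (2 ^ K * fact K * exp ((1 + x) / 2)))"
      by (intro mult_left_mono) auto
    also have "\<dots> = C * (2 ^ K * fact K) * exp (- x + (1 + x) / 2)"
      by (simp only: exp_add mult_ac)
    also have "- x + (1 + x) / 2 = 1/2 + - (1/2) * x"
      by (simp add: field_simps)
    also have "exp (1/2 + - (1/2) * x) = exp (1/2) * exp (- (1/2) * x)"
      by (rule exp_add)
    finally show ?thesis
      by (simp add: c_def mult.assoc)
  qed
  show ?thesis
    using int unfolding set_integrable_def
  proof (rule Bochner_Integration.integrable_bound)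
    show "(\<lambda>x. indicat_real {0<..} x *\<^sub>R exp (- x) *\<^sub>R f x) \<in> borel_measurable lborel"
      unfolding measurable_lborel2 using assms(2)
      by (intro borel_measurable_continuous_on_indicator continuous_intros) simp_all
    show "AE x in lborel. norm (indicat_real {0<..} x *\<^sub>R exp (- x) *\<^sub>R f x)
        \<le> norm (indicat_real {0<..} x *\<^sub>R (c * exp (- (1/2) * x)))"
      using order_trans[OF bound abs_ge_self] by (intro AE_I2) (simp add: indicator_def)
  qed
qed

section \<open>Symmetry\<close>

lemma bounded_linear_mat_adjoint: "bounded_linear (mat_adjoint :: 'n::finite cmat \<Rightarrow> _)"
  unfolding linear_conv_bounded_linear[symmetric]
  by (auto intro!: linearI simp: mat_adjoint_def transpose_def map_matrix_def vec_eq_iff)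

lemmas mat_adjoint_linear =
  linear_add[OF bounded_linear.linear[OF bounded_linear_mat_adjoint]]
  linear_diff[OF bounded_linear.linear[OF bounded_linear_mat_adjoint]]
  linear_scale[OF bounded_linear.linear[OF bounded_linear_mat_adjoint]]
  linear_0[OF bounded_linear.linear[OF bounded_linear_mat_adjoint]]

lemma mat_adjoint_mult: "mat_adjoint (X ** Y) = mat_adjoint Y ** mat_adjoint X"
  by (simp add: mat_adjoint_def transpose_def map_matrix_def vec_eq_iff matrix_matrix_mult_def mult.commute)

lemma mat_adjoint_diag_mat: "mat_adjoint (diag_mat d) = diag_mat d"
  by (auto simp: mat_adjoint_def transpose_def map_matrix_def vec_eq_iff diag_mat_def)

lemma diag_mat_mult: "diag_mat d ** diag_mat e = diag_mat (\<lambda>k. d k * e k)"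
  unfolding vec_eq_iff diag_mat_mult_left by (simp add: diag_mat_def)

lemma matrix_mult_has_vector_derivative:
  fixes f g :: "real \<Rightarrow> 'n::finite cmat"
  shows "(f has_vector_derivative f') (at x within S) \<Longrightarrow> (g has_vector_derivative g') (at x within S) \<Longrightarrow>
    ((\<lambda>x. f x ** g x) has_vector_derivative f x ** g' + f' ** g x) (at x within S)"
  by (rule bounded_bilinear.has_vector_derivative[OF bounded_bilinear_matrix_mult])

lemmas continuous_on_matrix_mult = bounded_bilinear.continuous_on[OF bounded_bilinear_matrix_mult]

lemmas mat_adjoint_has_vector_derivative =
  bounded_linear.has_vector_derivative[OF bounded_linear_mat_adjoint]

lemmas continuous_on_mat_adjoint =
  bounded_linear.continuous_on[OF bounded_linear_mat_adjoint]

lemma continuous_on_diag_mat: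
  assumes "\<And>k. continuous_on S (d k)"
  shows "continuous_on S (\<lambda>x. diag_mat (\<lambda>k. d k x))"
  unfolding diag_mat_def
proof (intro continuous_on_vec_lambda)
  show "continuous_on S (\<lambda>x. if k = j then complex_of_real (d k x) else 0)" for k j
    using assms[of k] by (cases "k = j") (simp_all add: continuous_on_of_real)
qed

lemma diag_mat_has_vector_derivative:
  assumes "\<And>k. (d k has_real_derivative d' k) (at x within S)"
  shows "((\<lambda>x. diag_mat (\<lambda>k. d k x)) has_vector_derivative diag_mat d') (at x within S)"
proof -
  have "((\<lambda>x. diag_mat (\<lambda>k. d k x) $ i $ j) has_vector_derivative diag_mat d' $ i $ j) (at x within S)" for i j
    using assms[of i]
    by (auto simp: diag_mat_def has_real_derivative_iff_has_vector_derivative intro: has_vector_derivative_of_real)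
  then show ?thesis
    by (intro has_vector_derivative_vec)
qed

lemma matrix_mult_norm_bound:
  obtains b where "b > 0" "\<And>(X :: 'n::finite cmat) (Y :: 'n cmat). norm (X ** Y) \<le> norm X * norm Y * b"
  using bounded_bilinear.pos_bounded[OF bounded_bilinear_matrix_mult[where 'n = 'n]]
  by (elim exE conjE) (rule that, auto)

lemma weighted_product_norm_bound:
  obtains C :: real where "C \<ge> 0"
    "\<And>(X :: 'n::finite cmat) (Y :: 'n cmat) (Z :: 'n cmat). norm (X ** Y ** mat_adjoint Z) \<le> C * (norm X * norm Y * norm Z)"
proof -
  obtain b where b: "b > 0" "\<And>(X :: 'n cmat) (Y :: 'n cmat). norm (X ** Y) \<le> norm X * norm Y * b"
    by (rule matrix_mult_norm_bound) (rule that)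
  obtain a where a: "a > 0" "\<And>X :: 'n cmat. norm (mat_adjoint X) \<le> norm X * a"
    using bounded_linear.pos_bounded[OF bounded_linear_mat_adjoint[where 'n = 'n]] by (elim exE conjE) (rule that, auto)
  show thesis
  proof (rule that[of "b * b * a"])
    fix X Y Z :: "'n cmat"
    have "norm (X ** Y ** mat_adjoint Z) \<le> (norm X * norm Y * b) * (norm Z * a) * b"
      using a b by (intro order_trans[OF b(2)] mult_right_mono mult_mono) auto
    then show "norm (X ** Y ** mat_adjoint Z) \<le> b * b * a * (norm X * norm Y * norm Z)"
      by (simp only: mult_ac)
  qed (use a b in simp)
qed

lemma differentiable_on_deriv0:
  assumes "Q differentiable_on {0..}" "x \<ge> 0"
  shows "(Q has_vector_derivative deriv0 Q x) (at x within {0..})"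
  using assms unfolding deriv0_def
  by (subst vector_derivative_works[symmetric]) (auto simp: differentiable_on_def)

lemma at_within_halfline: "x > 0 \<Longrightarrow> at x within {0..} = at (x::real)"
  by (rule at_within_interior) simp

lemma C2_derivatives:
  assumes "C2 Q" "x > 0"
  shows "(Q has_vector_derivative deriv0 Q x) (at x)"
    and "(deriv0 Q has_vector_derivative deriv0 (deriv0 Q) x) (at x)"
  using assms differentiable_on_deriv0[of Q x] differentiable_on_deriv0[of "deriv0 Q" x]
  by (simp_all add: C2_def at_within_halfline)

lemma C2_continuous_on:
  assumes "C2 Q"
  shows "continuous_on {0..} Q" "continuous_on {0..} (deriv0 Q)" "continuous_on {0..} (deriv0 (deriv0 Q))"
  using assms by (simp_all add: C2_def differentiable_imp_continuous_on)

lemma continuous_on_F1: "continuous_on S (F1 \<alpha> \<nu> \<mu>)"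
  unfolding F1_def[abs_def] by (intro continuous_intros)

lemma continuous_on_F2: "continuous_on S F2"
  unfolding F2_def[abs_def] smat_eq by (intro continuous_on_diag_mat continuous_intros)

lemma F2_mult: "F2 x ** Y = x *\<^sub>R Y" "Y ** F2 x = x *\<^sub>R Y"
  unfolding F2_def smat_eq vec_eq_iff
  by (simp_all only: diag_mat_mult_left diag_mat_mult_right vector_scaleR_component) (simp_all add: scaleR_conv_of_real)

lemma continuous_on_Dop:
  assumes "C2 Q"
  shows "continuous_on {0..} (Dop \<alpha> \<nu> \<mu> Q)"
  unfolding Dop_def diffop_def[abs_def] F0_def[abs_def]
  by (intro continuous_on_add continuous_on_matrix_mult continuous_on_F1 continuous_on_F2 C2_continuous_on assms
      continuous_on_const)

text \<open>Passing from Q to Q L leaves only the diagonal factor T of the weight.\<close>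

lemma weight_sandwich:
  "X ** weight \<alpha> \<nu> \<mu> \<delta> x ** mat_adjoint Y
    = X ** Lmat \<alpha> \<mu> x ** Tmat \<nu> \<delta> x ** mat_adjoint (Y ** Lmat \<alpha> \<mu> x)"
  by (simp add: weight_def mat_adjoint_mult matrix_mul_assoc)

context
  fixes \<alpha> \<nu> :: real and \<mu> \<delta> :: "'n::{finite,linorder} \<Rightarrow> real"
  assumes \<mu>_nz: "\<And>k. \<mu> k \<noteq> 0" and \<nu>_pos: "\<nu> > 0"
begin

lemma continuous_on_Lmat: "continuous_on S (Lmat \<alpha> \<mu>)"
  by (intro continuous_at_imp_continuous_on ballI
      has_vector_derivative_continuous[OF Lmat_has_vector_derivative[OF \<mu>_nz]])

lemma continuous_on_Tmat: "continuous_on {0<..} (Tmat \<nu> \<delta>)"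
  unfolding Tmat_eq[abs_def]
  by (intro continuous_on_diag_mat continuous_intros) auto

lemma continuous_on_weight: "continuous_on {0<..} (weight \<alpha> \<nu> \<mu> \<delta>)"
  unfolding weight_def[abs_def]
  by (intro continuous_on_matrix_mult continuous_on_Lmat continuous_on_Tmat continuous_on_mat_adjoint)

text \<open>For R = Q L, the relation L' = L A makes the factor after x the derivative R'' and the
  factor before the first diagonal matrix R'; the right side is the diagonalised operator applied to
  R.\<close>

lemma Dop_mult_Lmat:
  fixes Q :: "real \<Rightarrow> 'n cmat"
  defines "L \<equiv> Lmat \<alpha> \<mu>" and "A \<equiv> Amat \<mu>"
  shows "Dop \<alpha> \<nu> \<mu> Q x ** L x
    = x *\<^sub>R (deriv0 (deriv0 Q) x ** L x + 2 *\<^sub>R (deriv0 Q x ** (L x ** A)) + Q x ** (L x ** A ** A))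
    + (deriv0 Q x ** L x + Q x ** (L x ** A)) ** diag_mat (\<lambda>k. \<nu> + 1 + real (idx k) - x)
    + Q x ** L x ** diag_mat (\<lambda>k. \<alpha> - \<nu> - real (idx k))"
proof -
  have "Dop \<alpha> \<nu> \<mu> Q x ** L x = deriv0 (deriv0 Q) x ** (F2 x ** L x)
      + deriv0 Q x ** (F1 \<alpha> \<nu> \<mu> x ** L x) + Q x ** (F0 \<alpha> \<nu> \<mu> x ** L x)"
    by (simp add: Dop_def diffop_def matrix_mult_algebra matrix_mul_assoc)
  then show ?thesis
    unfolding L_def A_def F2_mult F1_mult_Lmat[OF \<mu>_nz] F0_mult_Lmat[OF \<mu>_nz]
    by (simp add: matrix_mult_algebra matrix_mul_assoc scaleR_add_right algebra_simps)
qed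

lemma Dop_symmetric:
  fixes G H :: "real \<Rightarrow> 'n cmat"
  assumes G: "C2 G" and H: "C2 H"
    and adm: "admissible_pair (weight \<alpha> \<nu> \<mu> \<delta>) (Dop \<alpha> \<nu> \<mu>) G H"
  shows "(LINT x:{0<..}|lborel. Dop \<alpha> \<nu> \<mu> G x ** weight \<alpha> \<nu> \<mu> \<delta> x ** mat_adjoint (H x))
    = (LINT x:{0<..}|lborel. G x ** weight \<alpha> \<nu> \<mu> \<delta> x ** mat_adjoint (Dop \<alpha> \<nu> \<mu> H x))"
proof -
  define D where "D = Dop \<alpha> \<nu> \<mu>"
  define W where "W = weight \<alpha> \<nu> \<mu> \<delta>"
  define L where "L = Lmat \<alpha> \<mu>"
  define A where "A = Amat \<mu>"
  define T where "T = Tmat \<nu> \<delta>"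
  \<comment> \<open>This is x T(x) with the factor x absorbed into the power, a form that is
    differentiated directly and is continuous up to 0.\<close>
  define X where "X x = diag_mat (\<lambda>k. exp (- x) * x powr (\<nu> + real (idx k) + 1) * \<delta> k)" for x
  define \<Lambda> :: "real \<Rightarrow> 'n cmat" where "\<Lambda> x = diag_mat (\<lambda>k. \<nu> + 1 + real (idx k) - x)" for x
  define \<Omega> :: "'n cmat" where "\<Omega> = diag_mat (\<lambda>k. \<alpha> - \<nu> - real (idx k))"
  \<comment> \<open>\<open>R0 Q\<close> is Q L; \<open>R1 Q\<close> and \<open>R2 Q\<close> are its
    first and second derivatives.\<close>
  define R0 where "R0 Q x = Q x ** L x" for Q :: "real \<Rightarrow> 'n cmat" and x
  define R1 where "R1 Q x = deriv0 Q x ** L x + Q x ** (L x ** A)" for Q :: "real \<Rightarrow> 'n cmat" and x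
  define R2 where "R2 Q x = deriv0 (deriv0 Q) x ** L x + 2 *\<^sub>R (deriv0 Q x ** (L x ** A)) + Q x ** (L x ** A ** A)"
    for Q :: "real \<Rightarrow> 'n cmat" and x
  define B where "B x = R1 G x ** X x ** mat_adjoint (R0 H x) - R0 G x ** X x ** mat_adjoint (R1 H x)" for x
  define f where "f x = D G x ** W x ** mat_adjoint (H x) - G x ** W x ** mat_adjoint (D H x)" for x
  note adm' = adm[unfolded admissible_pair_def, folded D_def W_def]

  have X_eq: "X x = x *\<^sub>R T x" if "x > 0" for x
    using that unfolding X_def T_def Tmat_eq vec_eq_iff
    by (auto simp: diag_mat_def powr_add scaleR_conv_of_real[of _ "_ :: complex"])
  have X_deriv: "(X has_vector_derivative \<Lambda> x ** T x) (at x)" if "x > 0" for x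
    unfolding X_def[abs_def] \<Lambda>_def T_def Tmat_eq diag_mat_mult
  proof (rule diag_mat_has_vector_derivative)
    fix k :: 'n
    have "((\<lambda>x. exp (- x)) has_real_derivative - exp (- x)) (at x)"
      by (auto intro!: derivative_eq_intros)
    moreover have "((\<lambda>x. x powr (\<nu> + real (idx k) + 1)) has_real_derivative
        (\<nu> + real (idx k) + 1) * x powr (\<nu> + real (idx k))) (at x)"
      using has_real_derivative_powr[OF that, of "\<nu> + real (idx k) + 1"] by simp
    ultimately have "((\<lambda>x. exp (- x) * x powr (\<nu> + real (idx k) + 1) * \<delta> k) has_real_derivative
        (- exp (- x) * x powr (\<nu> + real (idx k) + 1)
          + (\<nu> + real (idx k) + 1) * x powr (\<nu> + real (idx k)) * exp (- x)) * \<delta> k) (at x)"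
      by (intro DERIV_cmult_right DERIV_mult)
    then show "((\<lambda>x. exp (- x) * x powr (\<nu> + real (idx k) + 1) * \<delta> k) has_real_derivative
        (\<nu> + 1 + real (idx k) - x) * (exp (- x) * x powr (\<nu> + real (idx k)) * \<delta> k)) (at x)"
      using that by (simp add: powr_add algebra_simps)
  qed
  have comm: "\<Lambda> x ** T x = T x ** \<Lambda> x" "\<Omega> ** T x = T x ** \<Omega>" for x
    unfolding \<Lambda>_def \<Omega>_def T_def Tmat_eq diag_mat_mult by (simp_all add: mult.commute)
  \<comment> \<open>Right-nested forms, so that rewriting finds the commuting factors inside longer
    products.\<close>
  then have comm': "\<Lambda> x ** (T x ** Y) = T x ** (\<Lambda> x ** Y)" "\<Omega> ** (T x ** Y) = T x ** (\<Omega> ** Y)" for x Y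
    by (simp_all add: matrix_mul_assoc)
  have selfadj: "mat_adjoint (\<Lambda> x) = \<Lambda> x" "mat_adjoint \<Omega> = \<Omega>" for x
    by (simp_all add: \<Lambda>_def \<Omega>_def mat_adjoint_diag_mat)
  have L_deriv: "(L has_vector_derivative L x ** A) (at x)" for x
    unfolding L_def A_def by (rule Lmat_has_vector_derivative[OF \<mu>_nz])
  have R0_deriv: "(R0 Q has_vector_derivative R1 Q x) (at x)" if "C2 Q" "x > 0" for Q x
    unfolding R0_def[abs_def] R1_def
    using matrix_mult_has_vector_derivative[OF C2_derivatives(1)[OF that] L_deriv]
    by (simp add: add.commute)
  have R1_deriv: "(R1 Q has_vector_derivative R2 Q x) (at x)" if "C2 Q" "x > 0" for Q x
  proof -
    have "((\<lambda>x. L x ** A) has_vector_derivative L x ** A ** A) (at x)"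
      using matrix_mult_has_vector_derivative[OF L_deriv has_vector_derivative_const[of A]]
      by (simp add: matrix_mult_algebra)
    from has_vector_derivative_add[OF
        matrix_mult_has_vector_derivative[OF C2_derivatives(2)[OF that] L_deriv]
        matrix_mult_has_vector_derivative[OF C2_derivatives(1)[OF that] this]]
    show ?thesis
      unfolding R1_def[abs_def] R2_def by (simp add: scaleR_2 algebra_simps)
  qed
  have conj: "D Q x ** L x = x *\<^sub>R R2 Q x + R1 Q x ** \<Lambda> x + R0 Q x ** \<Omega>" for Q x
    unfolding D_def L_def R0_def R1_def R2_def \<Lambda>_def \<Omega>_def A_def by (rule Dop_mult_Lmat)

  define Z where "Z = mat 1 - matrix_inv (A + smat 1)"
  obtain C where C: "C \<ge> 0" "\<And>(X :: 'n cmat) (Y :: 'n cmat) (Z :: 'n cmat). norm (X ** Y ** mat_adjoint Z) \<le> C * (norm X * norm Y * norm Z)"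
    using weighted_product_norm_bound by blast
  obtain b where b: "b > 0" "\<And>(X :: 'n cmat) (Y :: 'n cmat). norm (X ** Y) \<le> norm X * norm Y * b"
    by (rule matrix_mult_norm_bound) (rule that)
  let ?I = "\<lambda>Q K x. norm (Q x :: 'n cmat) * norm (W x) * norm (K x :: 'n cmat)"
  \<comment> \<open>Bounds the norm of B / x. Writing R' = (Q' + Q Z) L leaves only norms of G, H,
    their derivatives and the weight; the Z-terms from G and from H account for the factor
    2.\<close>
  let ?g = "\<lambda>x. C * ?I (deriv0 G) H x + C * ?I G (deriv0 H) x + 2 * C * norm Z * b * ?I G H x"
  have "(LINT x:{0<..}|lborel. f x) = 0"
  proof (rule integral_derivative_eq_0)
    show "(B has_vector_derivative f x) (at x)" if x: "x > 0" for x
    proof -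
      note derivs = R0_deriv[OF G x] R1_deriv[OF G x]
        mat_adjoint_has_vector_derivative[OF R0_deriv[OF H x]]
        mat_adjoint_has_vector_derivative[OF R1_deriv[OF H x]]
      let ?B' = "R1 G x ** X x ** mat_adjoint (R1 H x) + (R1 G x ** (\<Lambda> x ** T x) + R2 G x ** X x) ** mat_adjoint (R0 H x)
          - (R0 G x ** X x ** mat_adjoint (R2 H x) + (R0 G x ** (\<Lambda> x ** T x) + R1 G x ** X x) ** mat_adjoint (R1 H x))"
      have "(B has_vector_derivative ?B') (at x)"
        unfolding B_def[abs_def]
        by (intro has_vector_derivative_diff matrix_mult_has_vector_derivative X_deriv derivs x)
      moreover have "f x = (x *\<^sub>R R2 G x + R1 G x ** \<Lambda> x + R0 G x ** \<Omega>) ** T x ** mat_adjoint (R0 H x)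
          - R0 G x ** T x ** mat_adjoint (x *\<^sub>R R2 H x + R1 H x ** \<Lambda> x + R0 H x ** \<Omega>)"
        unfolding f_def W_def weight_sandwich conj[symmetric] by (simp add: L_def T_def R0_def)
      \<comment> \<open>The \<Omega>-terms of f cancel because \<Omega> is real and diagonal; in
        \<open>?B'\<close> the two products of \<open>R1 G\<close> with the adjoint of
        \<open>R1 H\<close> cancel.\<close>
      then have "f x = ?B'"
        by (simp add: X_eq[OF x] matrix_mult_algebra mat_adjoint_linear mat_adjoint_mult selfadj
            comm' comm algebra_simps flip: matrix_mul_assoc)
      ultimately show ?thesis
        by (simp only:)
    qed
    show "continuous_on {0<..} f"
      unfolding f_def[abs_def] W_def D_def
      by (intro continuous_on_diff continuous_on_matrix_mult continuous_on_mat_adjoint continuous_on_weight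
          continuous_on_subset[OF continuous_on_Dop] continuous_on_subset[OF C2_continuous_on(1)] G H) auto
    show "set_integrable lborel {0<..} f"
      unfolding f_def[abs_def] using adm' by (intro set_integral_diff) auto
    show "(B \<longlongrightarrow> 0) (at_right 0)"
    proof -
      have "continuous_on {0..} X"
        unfolding X_def[abs_def] using \<nu>_pos
        by (intro continuous_on_diag_mat continuous_intros continuous_on_powr') (auto simp: add_pos_nonneg)
      then have "continuous_on {0..} B"
        unfolding B_def[abs_def] R0_def[abs_def] R1_def[abs_def] L_def
        by (intro continuous_on_diff continuous_on_add continuous_on_matrix_mult continuous_on_mat_adjoint
          continuous_on_Lmat C2_continuous_on[OF G] C2_continuous_on[OF H] continuous_on_const)
      then have "(B \<longlongrightarrow> B 0) (at 0 within {0..})"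
        by (simp add: continuous_on_def)
      \<comment> \<open>By the convention \<open>0 powr a = 0\<close>; the exponents are positive,
        so this is also the limit from the right.\<close>
      moreover have "X 0 = 0"
        by (simp add: X_def diag_mat_def vec_eq_iff)
      then have "B 0 = 0"
        by (simp add: B_def matrix_mult_algebra)
      ultimately show ?thesis
        using tendsto_within_subset[where S = "{0..}" and T = "{0<..}"] by fastforce
    qed
    show "set_integrable lborel {0<..} ?g"
      using adm' by (intro set_integral_add set_integrable_mult_right) auto
    show "norm (B x) \<le> x * ?g x" if x: "x > 0" for x
    proof -
      have "L x ** A = Z ** L x"
        using matrix_inv_Amat_mult_Lmat[where \<mu> = \<mu> and \<alpha> = \<alpha> and x = x, OF \<mu>_nz]
        by (simp add: Z_def matrix_mult_algebra L_def A_def)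
      then have R1_eq: "R1 Q x = (deriv0 Q x + Q x ** Z) ** L x" for Q
        by (simp add: R1_def matrix_mult_algebra matrix_mul_assoc)
      let ?P = "\<lambda>Q. deriv0 Q x + Q x ** Z"
      have P: "norm (?P Q) \<le> norm (deriv0 Q x) + norm (Q x) * norm Z * b" for Q
        by (intro norm_triangle_le add_left_mono b)
      have "B x = x *\<^sub>R (?P G ** W x ** mat_adjoint (H x) - G x ** W x ** mat_adjoint (?P H))"
        unfolding W_def weight_sandwich
        by (simp add: B_def X_eq[OF x] R1_eq R0_def L_def T_def matrix_mult_algebra scaleR_diff_right)
      then have "norm (B x) = x * norm (?P G ** W x ** mat_adjoint (H x) - G x ** W x ** mat_adjoint (?P H))"
        using x by simp
      also have "\<dots> \<le> x * (C * (norm (?P G) * norm (W x) * norm (H x)) + C * (norm (G x) * norm (W x) * norm (?P H)))"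
        using x by (intro mult_left_mono norm_triangle_le_diff add_mono C) auto
      also have "\<dots> \<le> x * (C * ((norm (deriv0 G x) + norm (G x) * norm Z * b) * norm (W x) * norm (H x))
          + C * (norm (G x) * norm (W x) * (norm (deriv0 H x) + norm (H x) * norm Z * b)))"
        using x C(1) by (intro mult_left_mono add_mono mult_right_mono P) auto
      also have "\<dots> = x * ?g x"
        by (simp add: algebra_simps)
      finally show ?thesis .
    qed
  qed
  then show ?thesis
    unfolding f_def using adm' by (simp add: set_integral_diff D_def W_def)
qed

end

section \<open>Eigenvalue equation\<close>

text \<open>Degree strictly less than \<open>n\<close>; only the values on \<open>[0,\<infinity>)\<close> matter, because \<open>deriv0\<close> is
  unspecified elsewhere.\<close>

definition is_matpoly :: "nat \<Rightarrow> (real \<Rightarrow> 'n::finite cmat) \<Rightarrow> bool" where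
  "is_matpoly n p \<longleftrightarrow> (\<exists>C. \<forall>x\<ge>0. p x = (\<Sum>k<n. x ^ k *\<^sub>R C k))"

section \<open>Matrix polynomials on the closed half-line and their derivatives\<close>

lemma is_matpolyI:
  assumes "\<And>x. x \<ge> 0 \<Longrightarrow> p x = (\<Sum>k<n. x ^ k *\<^sub>R C k)"
  shows "is_matpoly n p"
  unfolding is_matpoly_def using assms by (intro exI[of _ C]) simp

lemma is_matpolyE:
  assumes "is_matpoly n p"
  obtains C where "\<And>x. x \<ge> 0 \<Longrightarrow> p x = (\<Sum>k<n. x ^ k *\<^sub>R C k)"
proof -
  obtain C where "\<forall>x\<ge>0. p x = (\<Sum>k<n. x ^ k *\<^sub>R C k)"
    using assms unfolding is_matpoly_def by (elim exE)
  then show thesis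
    by (intro that[of C]) simp
qed

lemma is_matpoly_cong:
  "(\<And>x. x \<ge> 0 \<Longrightarrow> p x = q x) \<Longrightarrow> is_matpoly n p \<longleftrightarrow> is_matpoly n q"
  by (simp add: is_matpoly_def)

lemma is_matpoly_sum: "is_matpoly n (\<lambda>x. \<Sum>k<n. x ^ k *\<^sub>R C k)"
  by (rule is_matpolyI) (rule refl)

lemma is_matpoly_add:
  assumes "is_matpoly n p" "is_matpoly n q"
  shows "is_matpoly n (\<lambda>x. p x + q x)"
proof -
  obtain C where C: "\<And>x. x \<ge> 0 \<Longrightarrow> p x = (\<Sum>k<n. x ^ k *\<^sub>R C k)"
    by (rule is_matpolyE[OF assms(1)]) (rule that)
  obtain E where E: "\<And>x. x \<ge> 0 \<Longrightarrow> q x = (\<Sum>k<n. x ^ k *\<^sub>R E k)"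
    by (rule is_matpolyE[OF assms(2)]) (rule that)
  show ?thesis
    by (rule is_matpolyI[where C = "\<lambda>k. C k + E k"]) (simp add: C E sum.distrib scaleR_add_right)
qed

lemma is_matpoly_mult_left:
  assumes "is_matpoly n p"
  shows "is_matpoly n (\<lambda>x. M ** p x)"
proof -
  obtain C where C: "\<And>x. x \<ge> 0 \<Longrightarrow> p x = (\<Sum>k<n. x ^ k *\<^sub>R C k)"
    by (rule is_matpolyE[OF assms]) (rule that)
  show ?thesis
    by (rule is_matpolyI[where C = "\<lambda>k. M ** C k"])
      (simp add: C bounded_bilinear.sum_right[OF bounded_bilinear_matrix_mult] matrix_mult_algebra)
qed

lemma is_matpoly_mono:
  assumes "is_matpoly m p" "m \<le> n"
  shows "is_matpoly n p"
proof -
  obtain C where C: "\<And>x. x \<ge> 0 \<Longrightarrow> p x = (\<Sum>k<m. x ^ k *\<^sub>R C k)"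
    by (rule is_matpolyE[OF assms(1)]) (rule that)
  have "(\<Sum>k<m. x ^ k *\<^sub>R C k) = (\<Sum>k<n. x ^ k *\<^sub>R (if k < m then C k else 0))" for x
    using assms(2) by (intro sum.mono_neutral_cong_left) auto
  then show ?thesis
    by (intro is_matpolyI[where C = "\<lambda>k. if k < m then C k else 0"]) (simp only: C)
qed

text \<open>Makes the derivative unique at the endpoint 0 as well, where only right-hand
  neighbourhoods are available.\<close>

lemma at_within_halfline_neq_bot:
  fixes x :: real
  assumes "x \<ge> 0"
  shows "at x within {0..} \<noteq> bot"
proof -
  have "at_right x \<le> at x within {0..}"
    using assms by (intro at_le) auto
  then show ?thesis
    using trivial_limit_at_right_real[of x] by (metis bot.extremum_uniqueI)
qed

lemma sum_power_has_vector_derivative: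
  "((\<lambda>x. \<Sum>k<n. x ^ k *\<^sub>R C k) has_vector_derivative (\<Sum>k<n. (real k * x ^ (k - 1)) *\<^sub>R C k)) (at x within S)"
  for C :: "nat \<Rightarrow> 'n::finite cmat"
proof (intro has_vector_derivative_sum)
  fix k
  have "((\<lambda>x. x ^ k) has_real_derivative real k * x ^ (k - 1)) (at x within S)"
    by (auto intro!: derivative_eq_intros)
  from has_vector_derivative_scaleR[OF this has_vector_derivative_const[of "C k"]]
  show "((\<lambda>x. x ^ k *\<^sub>R C k) has_vector_derivative (real k * x ^ (k - 1)) *\<^sub>R C k) (at x within S)"
    by simp
qed

context
  fixes p :: "real \<Rightarrow> 'n::finite cmat" and n C
  assumes p: "\<And>x. x \<ge> 0 \<Longrightarrow> p x = (\<Sum>k<n. x ^ k *\<^sub>R C k)"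
begin

lemma matpoly_has_vector_derivative:
  assumes "x \<ge> 0"
  shows "(p has_vector_derivative (\<Sum>k<n. (real k * x ^ (k - 1)) *\<^sub>R C k)) (at x within {0..})"
  using sum_power_has_vector_derivative by (rule has_vector_derivative_transform[rotated 2]) (use p assms in auto)

lemma matpoly_deriv0:
  "x \<ge> 0 \<Longrightarrow> deriv0 p x = (\<Sum>k<n. (real k * x ^ (k - 1)) *\<^sub>R C k)"
  unfolding deriv0_def
  by (intro vector_derivative_within at_within_halfline_neq_bot matpoly_has_vector_derivative)

text \<open>Reindexed, the derivative is again a plain power sum, so it can be differentiated once
  more and its degree bound can be read off.\<close>

lemma matpoly_deriv0_shift:
  assumes "x \<ge> 0"
  shows "deriv0 p x = (\<Sum>k<n - 1. x ^ k *\<^sub>R (real (Suc k) *\<^sub>R C (Suc k)))"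
proof (cases n)
  case (Suc m)
  then show ?thesis
    using assms by (simp add: matpoly_deriv0 sum.lessThan_Suc_shift mult.commute del: of_nat_Suc sum.lessThan_Suc)
qed (use assms in \<open>simp add: matpoly_deriv0\<close>)

end

lemma is_matpoly_deriv0:
  assumes "is_matpoly n p"
  shows "is_matpoly (n - 1) (deriv0 p)"
proof -
  obtain C where C: "\<And>x. x \<ge> 0 \<Longrightarrow> p x = (\<Sum>k<n. x ^ k *\<^sub>R C k)"
    by (rule is_matpolyE[OF assms]) (rule that)
  show ?thesis
    using matpoly_deriv0_shift[where p = p and n = n and C = C, OF C] by (rule is_matpolyI)
qed

lemma is_matpoly_differentiable:
  assumes "is_matpoly n p"
  shows "p differentiable_on {0..}"
proof -
  obtain C where C: "\<And>x. x \<ge> 0 \<Longrightarrow> p x = (\<Sum>k<n. x ^ k *\<^sub>R C k)"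
    by (rule is_matpolyE[OF assms]) (rule that)
  show ?thesis
    unfolding differentiable_on_def
    using matpoly_has_vector_derivative[where p = p and n = n and C = C, OF C] differentiableI_vector by force
qed

lemma is_matpoly_continuous_on: "is_matpoly n p \<Longrightarrow> continuous_on {0..} p"
  by (intro differentiable_imp_continuous_on is_matpoly_differentiable)

lemma is_matpoly_C2:
  assumes "is_matpoly n p"
  shows "C2 p"
  unfolding C2_def
  by (intro conjI is_matpoly_differentiable[OF assms] is_matpoly_differentiable[OF is_matpoly_deriv0[OF assms]]
      is_matpoly_continuous_on[OF is_matpoly_deriv0[OF is_matpoly_deriv0[OF assms]]])

lemma is_matpoly_poly_bounded:
  assumes "is_matpoly n p"
  shows "poly_bounded p"
proof -
  obtain C where C: "\<And>x. x \<ge> 0 \<Longrightarrow> p x = (\<Sum>k<n. x ^ k *\<^sub>R C k)"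
    by (rule is_matpolyE[OF assms]) (rule that)
  have "poly_bounded (\<lambda>x. \<Sum>k<n. x ^ k *\<^sub>R C k)"
    by (intro poly_bounded_sum poly_bounded_bilinear[OF bounded_bilinear_scaleR]
        poly_bounded_power poly_bounded_ident poly_bounded_const)
  then show ?thesis
    by (simp add: poly_bounded_def C)
qed

section \<open>Polynomial growth of L and of the weight without its exponential\<close>

lemma poly_bounded_vec:
  fixes f :: "real \<Rightarrow> 'a::euclidean_space ^ 'n::finite"
  assumes "\<And>i. poly_bounded (\<lambda>x. f x $ i)"
  shows "poly_bounded f"
proof -
  have "poly_bounded (\<lambda>x. \<Sum>i\<in>UNIV. axis i (f x $ i))"
    by (intro poly_bounded_sum poly_bounded_linear[OF bounded_linear_axis] assms)
  then show ?thesis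
    by (simp only: sum_axis)
qed

lemma poly_bounded_of_real: "poly_bounded f \<Longrightarrow> poly_bounded (\<lambda>x. of_real (f x) :: complex)"
  by (simp add: poly_bounded_def)

text \<open>Induction over the degree by \<open>laguerre_rec\<close>; a stays arbitrary because the
  recurrence raises it.\<close>

lemma poly_bounded_laguerre: "poly_bounded (laguerre n a)"
proof (induction n arbitrary: a)
  case 0
  then show ?case
    using poly_bounded_const[of "1::real"] by (simp add: poly_bounded_def)
next
  case (Suc n)
  have "laguerre (Suc n) a x = ((1 + a) * laguerre n (a + 1) x - x * laguerre n (a + 2) x) / real (Suc n)" for x
    using laguerre_rec[of n a x] by (simp add: eq_divide_eq mult.commute del: of_nat_Suc)
  then have "laguerre (Suc n) a x
      = (1 + a) / real (Suc n) * laguerre n (a + 1) x + (- 1 / real (Suc n) * x) * laguerre n (a + 2) x" for x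
    by (simp add: diff_divide_distrib)
  moreover have "poly_bounded (\<lambda>x. (1 + a) / real (Suc n) * laguerre n (a + 1) x
      + (- 1 / real (Suc n) * x) * laguerre n (a + 2) x)"
    by (intro poly_bounded_add poly_bounded_bilinear[OF bounded_bilinear_mult] Suc.IH
        poly_bounded_const poly_bounded_ident)
  ultimately show ?case
    by (simp add: poly_bounded_def)
qed

lemma poly_bounded_Lmat: "poly_bounded (Lmat \<alpha> \<mu>)"
proof (intro poly_bounded_vec)
  fix i j
  have "poly_bounded (\<lambda>x. \<mu> i / \<mu> j * laguerre k a x)" for k a
    by (intro poly_bounded_bilinear[OF bounded_bilinear_mult] poly_bounded_const poly_bounded_laguerre)
  then show "poly_bounded (\<lambda>x. Lmat \<alpha> \<mu> x $ i $ j)"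
    unfolding Lmat_def by (cases "j \<le> i") (simp_all only: vec_lambda_beta if_True if_False poly_bounded_of_real poly_bounded_const)
qed

lemma poly_bounded_diag_mat:
  assumes "\<And>k. poly_bounded (d k)"
  shows "poly_bounded (\<lambda>x. diag_mat (\<lambda>k. d k x))"
proof (intro poly_bounded_vec)
  show "poly_bounded (\<lambda>x. diag_mat (\<lambda>k. d k x) $ i $ j)" for i j
    by (cases "i = j") (simp_all add: diag_mat_def poly_bounded_of_real poly_bounded_const assms)
qed

lemma set_integral_bounded_linear:
  fixes f :: "_ \<Rightarrow> 'a::euclidean_space" and T :: "'a \<Rightarrow> 'b::euclidean_space"
  assumes "bounded_linear T" "set_integrable M S f"
  shows "(LINT x:S|M. T (f x)) = T (LINT x:S|M. f x)"
proof -
  have "(LINT x:S|M. T (f x)) = (LINT x|M. T (indicator S x *\<^sub>R f x))"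
    unfolding set_lebesgue_integral_def by (simp add: linear_scale[OF bounded_linear.linear[OF assms(1)]])
  also have "\<dots> = T (LINT x:S|M. f x)"
    using assms unfolding set_lebesgue_integral_def set_integrable_def by (intro integral_bounded_linear)
  finally show ?thesis .
qed

definition weight_without_exp :: "real \<Rightarrow> real \<Rightarrow> ('n::{finite,linorder} \<Rightarrow> real) \<Rightarrow> ('n \<Rightarrow> real) \<Rightarrow> real \<Rightarrow> 'n cmat" where
  "weight_without_exp \<alpha> \<nu> \<mu> \<delta> x = Lmat \<alpha> \<mu> x ** diag_mat (\<lambda>k. x powr (\<nu> + real (idx k)) * \<delta> k) ** mat_adjoint (Lmat \<alpha> \<mu> x)"

lemma weight_eq_exp: "weight \<alpha> \<nu> \<mu> \<delta> x = exp (- x) *\<^sub>R weight_without_exp \<alpha> \<nu> \<mu> \<delta> x"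
proof -
  have "Tmat \<nu> \<delta> x = exp (- x) *\<^sub>R diag_mat (\<lambda>k. x powr (\<nu> + real (idx k)) * \<delta> k)"
    unfolding Tmat_eq vec_eq_iff
    by (simp only: vector_scaleR_component) (simp add: diag_mat_def scaleR_conv_of_real)
  then show ?thesis
    by (simp add: weight_def weight_without_exp_def matrix_mult_algebra)
qed

text \<open>In a nonzero row of X take the last nonzero entry, in column j. In column j of X L it
  alone survives: later entries of X vanish, L is zero above the diagonal, and its diagonal is
  1.\<close>

lemma Lmat_cancel:
  assumes "X ** Lmat \<alpha> \<mu> x = 0" and \<mu>_nz: "\<And>k. \<mu> k \<noteq> 0"
  shows "X = 0"
proof (rule ccontr)
  assume "X \<noteq> 0"
  then obtain i j0 where "X $ i $ j0 \<noteq> 0"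
    by (auto simp: vec_eq_iff)
  define j where "j = Max {j. X $ i $ j \<noteq> 0}"
  have j: "X $ i $ j \<noteq> 0"
    using Max_in[of "{j. X $ i $ j \<noteq> 0}"] \<open>X $ i $ j0 \<noteq> 0\<close> unfolding j_def by auto
  have upper: "X $ i $ k = 0" if "k > j" for k
  proof (rule ccontr)
    assume "X $ i $ k \<noteq> 0"
    then have "k \<le> j"
      unfolding j_def by (intro Max_ge) auto
    with that show False
      by simp
  qed
  have "X $ i $ k * Lmat \<alpha> \<mu> x $ k $ j = (if k = j then X $ i $ j else 0)" for k
    using upper[of k] \<mu>_nz[of j] by (cases k j rule: linorder_cases) (auto simp: Lmat_def)
  then have "(X ** Lmat \<alpha> \<mu> x) $ i $ j = X $ i $ j"
    by (simp add: matrix_matrix_mult_def)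
  with j assms(1) show False
    by simp
qed

section \<open>Integrability, action on polynomials, orthogonality and definiteness for the given
  weight\<close>

context
  fixes \<alpha> \<nu> :: real and \<mu> \<delta> :: "'n::{finite,linorder} \<Rightarrow> real"
  assumes \<mu>_nz: "\<And>k. \<mu> k \<noteq> 0" and \<nu>_pos: "\<nu> > 0" and \<delta>_pos: "\<And>k. \<delta> k > 0"
begin

private abbreviation (input) "W \<equiv> weight \<alpha> \<nu> \<mu> \<delta>"
private abbreviation (input) "D \<equiv> Dop \<alpha> \<nu> \<mu>"
private abbreviation (input) "V \<equiv> weight_without_exp \<alpha> \<nu> \<mu> \<delta>"

lemma poly_bounded_weight_without_exp: "poly_bounded V"
  unfolding weight_without_exp_def[abs_def] using \<nu>_pos
  by (intro poly_bounded_bilinear[OF bounded_bilinear_matrix_mult] poly_bounded_Lmat poly_bounded_diag_mat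
      poly_bounded_linear[OF bounded_linear_mat_adjoint] poly_bounded_bilinear[OF bounded_bilinear_mult]
      poly_bounded_powr poly_bounded_const) simp

lemma continuous_on_weight_without_exp: "continuous_on {0<..} V"
  unfolding weight_without_exp_def[abs_def]
  by (intro continuous_on_matrix_mult continuous_on_Lmat[OF \<mu>_nz \<nu>_pos] continuous_on_diag_mat
      continuous_on_mat_adjoint continuous_intros) auto

lemma is_matpoly_integrable:
  assumes "is_matpoly m p" "is_matpoly n q"
  shows "set_integrable lborel {0<..} (\<lambda>x. p x ** W x ** mat_adjoint (q x))"
    and "set_integrable lborel {0<..} (\<lambda>x. norm (p x) * norm (W x) * norm (q x))"
proof -
  have cont: "continuous_on {0<..} p" "continuous_on {0<..} q"
    using assms[THEN is_matpoly_continuous_on] by (auto intro: continuous_on_subset)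
  have "set_integrable lborel {0<..} (\<lambda>x. exp (- x) *\<^sub>R (p x ** V x ** mat_adjoint (q x)))"
    by (intro set_integrable_exp_times_poly_bounded poly_bounded_bilinear[OF bounded_bilinear_matrix_mult]
        poly_bounded_linear[OF bounded_linear_mat_adjoint] poly_bounded_weight_without_exp
        is_matpoly_poly_bounded[OF assms(1)] is_matpoly_poly_bounded[OF assms(2)]
        continuous_on_matrix_mult continuous_on_mat_adjoint continuous_on_weight_without_exp cont)
  then show "set_integrable lborel {0<..} (\<lambda>x. p x ** W x ** mat_adjoint (q x))"
    by (simp add: weight_eq_exp matrix_mult_algebra)
  have "set_integrable lborel {0<..} (\<lambda>x. exp (- x) *\<^sub>R (norm (p x) * norm (V x) * norm (q x)))"
    by (intro set_integrable_exp_times_poly_bounded poly_bounded_bilinear[OF bounded_bilinear_mult]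
        poly_bounded_norm poly_bounded_weight_without_exp
        is_matpoly_poly_bounded[OF assms(1)] is_matpoly_poly_bounded[OF assms(2)]
        continuous_on_mult continuous_on_norm continuous_on_weight_without_exp cont)
  then show "set_integrable lborel {0<..} (\<lambda>x. norm (p x) * norm (W x) * norm (q x))"
    by (simp add: weight_eq_exp mult_ac)
qed

text \<open>The operator splits by degree: the x-part of F1 together with F0 keeps each power and
  multiplies its coefficient by \<open>Gam\<close>, while x p'' and p' K lower the degree by
  one.\<close>

lemma Dop_sum_power:
  assumes p: "\<And>x. x \<ge> 0 \<Longrightarrow> p x = (\<Sum>k<n. x ^ k *\<^sub>R C k)"
  defines "K \<equiv> smat \<nu> + Jmat + smat 1 + (smat \<alpha> + Jmat) ** Amat \<mu>"
  assumes x: "x \<ge> 0"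
  shows "D p x = (\<Sum>k<n. x ^ k *\<^sub>R (C k ** Gam \<alpha> \<nu> \<mu> k))
    + (\<Sum>k<n - 1. x ^ k *\<^sub>R (real (Suc k) *\<^sub>R (real k *\<^sub>R C (Suc k) + C (Suc k) ** K)))"
proof -
  let ?M = "matrix_inv (Amat \<mu> + smat 1)"
  \<comment> \<open>At k = 0 the truncated exponent k - 1 is harmless, since the factor k is
    0.\<close>
  have scale_power: "x *\<^sub>R ((real k * x ^ (k - 1)) *\<^sub>R M) = x ^ k *\<^sub>R (real k *\<^sub>R M)" for k and M :: "'n cmat"
    by (cases k) (simp_all add: mult_ac)
  have p1: "deriv0 p x = (\<Sum>k<n - 1. x ^ k *\<^sub>R (real (Suc k) *\<^sub>R C (Suc k)))" if "x \<ge> 0" for x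
    using p that by (rule matpoly_deriv0_shift)
  have p1': "deriv0 p x = (\<Sum>k<n. (real k * x ^ (k - 1)) *\<^sub>R C k)"
    using p x by (rule matpoly_deriv0)
  have p2: "deriv0 (deriv0 p) x = (\<Sum>k<n - 1. (real k * x ^ (k - 1)) *\<^sub>R (real (Suc k) *\<^sub>R C (Suc k)))"
    using p1 x by (rule matpoly_deriv0)
  have xdd: "x *\<^sub>R deriv0 (deriv0 p) x = (\<Sum>k<n - 1. x ^ k *\<^sub>R (real (Suc k) *\<^sub>R (real k *\<^sub>R C (Suc k))))"
    unfolding p2 scaleR_sum_right
    by (intro sum.cong refl) (simp only: scale_power, simp only: scaleR_scaleR mult_ac)
  have dK: "deriv0 p x ** K = (\<Sum>k<n - 1. x ^ k *\<^sub>R (real (Suc k) *\<^sub>R (C (Suc k) ** K)))"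
    by (simp add: p1[OF x] bounded_bilinear.sum_left[OF bounded_bilinear_matrix_mult] matrix_mult_algebra)
  have xd: "x *\<^sub>R deriv0 p x = (\<Sum>k<n. x ^ k *\<^sub>R (real k *\<^sub>R C k))"
    unfolding p1' scaleR_sum_right
    by (intro sum.cong refl) (simp only: scale_power)
  have "- (x *\<^sub>R deriv0 p x ** ?M) + p x ** F0 \<alpha> \<nu> \<mu> x
      = (\<Sum>k<n. - (x ^ k *\<^sub>R (real k *\<^sub>R C k) ** ?M) + x ^ k *\<^sub>R C k ** F0 \<alpha> \<nu> \<mu> x)"
    unfolding xd p[OF x]
    by (simp only: bounded_bilinear.sum_left[OF bounded_bilinear_matrix_mult] sum_negf sum.distrib)
  also have "\<dots> = (\<Sum>k<n. x ^ k *\<^sub>R (C k ** Gam \<alpha> \<nu> \<mu> k))"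
    by (intro sum.cong refl) (simp add: matrix_mult_algebra F0_def Gam_def algebra_simps)
  finally have "- (x *\<^sub>R deriv0 p x ** ?M) + p x ** F0 \<alpha> \<nu> \<mu> x = (\<Sum>k<n. x ^ k *\<^sub>R (C k ** Gam \<alpha> \<nu> \<mu> k))" .
  moreover have "D p x = (x *\<^sub>R deriv0 (deriv0 p) x + deriv0 p x ** K)
      + (- (x *\<^sub>R deriv0 p x ** ?M) + p x ** F0 \<alpha> \<nu> \<mu> x)"
    by (simp add: Dop_def diffop_def F2_mult F1_def K_def matrix_mult_algebra)
  ultimately show ?thesis
    by (simp only: xdd dK sum.distrib scaleR_add_right add_ac)
qed

lemma is_matpoly_Dop:
  assumes "is_matpoly n p"
  shows "is_matpoly n (D p)"
proof -
  obtain C where C: "\<And>x. x \<ge> 0 \<Longrightarrow> p x = (\<Sum>k<n. x ^ k *\<^sub>R C k)"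
    by (rule is_matpolyE[OF assms]) (rule that)
  show ?thesis
    by (rule iffD2[OF is_matpoly_cong], rule Dop_sum_power[where p = p and n = n and C = C, OF C], assumption+,
        intro is_matpoly_add is_matpoly_sum is_matpoly_mono[OF is_matpoly_sum diff_le_self])
qed

lemma monic_decompose:
  assumes "monic_matpoly n p"
  obtains C where "C n = mat 1" "\<And>x. p x = (\<Sum>k<Suc n. x ^ k *\<^sub>R C k)"
proof -
  obtain C where "C n = mat 1" "\<And>x. p x = (\<Sum>k\<le>n. x ^ k *\<^sub>R C k)"
    using assms unfolding monic_matpoly_def by auto
  then show thesis
    by (intro that[of C]) (simp_all only: lessThan_Suc_atMost)
qed

lemma monic_is_matpoly: "monic_matpoly n p \<Longrightarrow> is_matpoly (Suc n) p"
  by (erule monic_decompose) (rule is_matpolyI)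

text \<open>The leading coefficient of p is the identity, so both terms have \<open>Gam\<close> at n
  as coefficient of the n-th power, and these cancel.\<close>

lemma Dop_monic:
  assumes "monic_matpoly n p"
  shows "is_matpoly n (\<lambda>x. D p x - Gam \<alpha> \<nu> \<mu> n ** p x)"
proof -
  obtain C where C: "C n = mat 1" "\<And>x. p x = (\<Sum>k<Suc n. x ^ k *\<^sub>R C k)"
    using assms by (rule monic_decompose) (rule that)
  let ?G = "Gam \<alpha> \<nu> \<mu>"
  let ?K = "smat \<nu> + Jmat + smat 1 + (smat \<alpha> + Jmat) ** Amat \<mu>"
  have eq: "D p x - ?G n ** p x = (\<Sum>k<n. x ^ k *\<^sub>R (C k ** ?G k - ?G n ** C k))
      + (\<Sum>k<n. x ^ k *\<^sub>R (real (Suc k) *\<^sub>R (real k *\<^sub>R C (Suc k) + C (Suc k) ** ?K)))" if "x \<ge> 0" for x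
    using Dop_sum_power[where p = p and n = "Suc n" and C = C, OF C(2) that]
    by (simp add: C bounded_bilinear.sum_right[OF bounded_bilinear_matrix_mult] matrix_mult_algebra
        sum_subtractf scaleR_diff_right)
  show ?thesis
    by (rule iffD2[OF is_matpoly_cong], rule eq, assumption, intro is_matpoly_add is_matpoly_sum)
qed

lemma admissible_matpoly:
  assumes "is_matpoly m p" "is_matpoly n q"
  shows "admissible_pair W D p q"
  unfolding admissible_pair_def
  by (intro conjI is_matpoly_integrable[OF is_matpoly_Dop[OF assms(1)] assms(2)]
      is_matpoly_integrable[OF assms(1) is_matpoly_Dop[OF assms(2)]] is_matpoly_integrable[OF assms]
      is_matpoly_integrable[OF is_matpoly_deriv0[OF assms(1)] assms(2)]
      is_matpoly_integrable[OF assms(1) is_matpoly_deriv0[OF assms(2)]])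

text \<open>Induction on the degree bound: a left multiple of the monic \<open>P m\<close> removes
  the top coefficient of q, and its constant factor leaves the integral on the right as an
  adjoint.\<close>

lemma orthogonal_lower_degree:
  assumes P: "monic_MVOPs W P" and "is_matpoly m q" "m \<le> n"
  shows "(LINT x:{0<..}|lborel. P n x ** W x ** mat_adjoint (q x)) = 0"
  using assms(2,3)
proof (induction m arbitrary: q)
  case 0
  then have "q x = 0" if "x \<ge> 0" for x
    using that by (simp add: is_matpoly_def)
  then have "\<forall>x. x \<in> {0<..} \<longrightarrow> P n x ** W x ** mat_adjoint (q x) = 0"
    by (simp add: mat_adjoint_linear matrix_mult_algebra)
  then have "(LINT x:{0<..}|lborel. P n x ** W x ** mat_adjoint (q x)) = (LINT x:{0<..}|(lborel :: real measure). 0)"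
    by (intro set_lebesgue_integral_cong) simp_all
  then show ?case
    by simp
next
  case (Suc m)
  have monic: "monic_matpoly m (P m)" "monic_matpoly n (P n)"
    using P by (auto simp: monic_MVOPs_def)
  note Pm = monic_is_matpoly[OF monic(1)] and Pn = monic_is_matpoly[OF monic(2)]
  obtain C where C: "\<And>x. x \<ge> 0 \<Longrightarrow> q x = (\<Sum>k<Suc m. x ^ k *\<^sub>R C k)"
    by (rule is_matpolyE[OF Suc.prems(1)]) (rule that)
  obtain E where E: "E m = mat 1" "\<And>x. P m x = (\<Sum>k<Suc m. x ^ k *\<^sub>R E k)"
    using monic(1) by (rule monic_decompose) (rule that)
  \<comment> \<open>What remains of q after subtracting \<open>C m ** P m x\<close>; the power m
    drops out because \<open>E m\<close> is the identity.\<close>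
  define r where "r x = (\<Sum>k<m. x ^ k *\<^sub>R (C k - C m ** E k))" for x
  have r: "is_matpoly m r"
    unfolding r_def by (rule is_matpoly_sum)
  have q: "q x = C m ** P m x + r x" if "x \<ge> 0" for x
    by (simp add: C[OF that] E r_def bounded_bilinear.sum_right[OF bounded_bilinear_matrix_mult]
        matrix_mult_algebra scaleR_diff_right sum_subtractf)
  have "(LINT x:{0<..}|lborel. P n x ** W x ** mat_adjoint (q x))
      = (LINT x:{0<..}|lborel. P n x ** W x ** mat_adjoint (P m x) ** mat_adjoint (C m)
          + P n x ** W x ** mat_adjoint (r x))"
    by (intro set_lebesgue_integral_cong)
      (simp_all add: q mat_adjoint_linear mat_adjoint_mult matrix_mult_algebra matrix_mul_assoc)
  also have "\<dots> = (LINT x:{0<..}|lborel. P n x ** W x ** mat_adjoint (P m x) ** mat_adjoint (C m))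
      + (LINT x:{0<..}|lborel. P n x ** W x ** mat_adjoint (r x))"
  proof (rule set_integral_add(2)[OF _ is_matpoly_integrable(1)[OF Pn r]])
    show "set_integrable lborel {0<..} (\<lambda>x. P n x ** W x ** mat_adjoint (P m x) ** mat_adjoint (C m))"
      using is_matpoly_integrable(1)[OF Pn is_matpoly_mult_left[where M = "C m", OF Pm]]
      by (simp add: mat_adjoint_mult matrix_mul_assoc)
  qed
  also have "(LINT x:{0<..}|lborel. P n x ** W x ** mat_adjoint (P m x) ** mat_adjoint (C m))
      = (LINT x:{0<..}|lborel. P n x ** W x ** mat_adjoint (P m x)) ** mat_adjoint (C m)"
    by (intro set_integral_bounded_linear bounded_bilinear.bounded_linear_left[OF bounded_bilinear_matrix_mult]
        is_matpoly_integrable(1)[OF Pn Pm])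
  also have "(LINT x:{0<..}|lborel. P n x ** W x ** mat_adjoint (P m x)) = 0"
    using P Suc.prems(2) by (simp add: monic_MVOPs_def)
  also have "(LINT x:{0<..}|lborel. P n x ** W x ** mat_adjoint (r x)) = 0"
    using r Suc.prems(2) by (intro Suc.IH) auto
  finally show ?case
    by (simp add: matrix_mult_algebra)
qed

text \<open>Each diagonal entry of the integrand is a sum of squared moduli of entries of q L with
  positive weights. A zero integral makes q L vanish, and L can be cancelled.\<close>

lemma norm_integral_0_imp_0:
  assumes q: "is_matpoly n q" and zero: "(LINT x:{0<..}|lborel. q x ** W x ** mat_adjoint (q x)) = 0"
    and x: "x \<ge> 0"
  shows "q x = 0"
proof -
  have pos: "q x = 0" if "x > 0" for x
  proof -
    define R where "R x = q x ** Lmat \<alpha> \<mu> x" for x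
    define t where "t k x = exp (- x) * x powr (\<nu> + real (idx k)) * \<delta> k" for k x
    have t: "t k x > 0" if "x > 0" for k x
      using that \<delta>_pos by (simp add: t_def)
    have diag: "Re ((q x ** W x ** mat_adjoint (q x)) $ i $ i) = (\<Sum>k\<in>UNIV. t k x * (cmod (R x $ i $ k))\<^sup>2)" for i x
    proof -
      have "(q x ** W x ** mat_adjoint (q x)) $ i $ i
          = (\<Sum>k\<in>UNIV. R x $ i $ k * of_real (t k x) * cnj (R x $ i $ k))"
        unfolding weight_sandwich Tmat_eq R_def[symmetric] t_def[symmetric]
        by (simp only: matrix_matrix_mult_def[of "R x ** diag_mat _"])
          (simp add: diag_mat_mult_right mat_adjoint_def transpose_def map_matrix_def)
      also have "\<dots> = (\<Sum>k\<in>UNIV. of_real (t k x * (cmod (R x $ i $ k))\<^sup>2))"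
        by (intro sum.cong refl) (simp add: complex_norm_square mult_ac del: of_real_power)
      finally show ?thesis
        by simp
    qed
    have "R x $ i $ k = 0" for i k
    proof -
      let ?h = "\<lambda>x. Re ((q x ** W x ** mat_adjoint (q x)) $ i $ i)"
      have bl: "bounded_linear (\<lambda>M :: 'n cmat. Re (M $ i $ i))"
        by (intro bounded_linear_compose[OF bounded_linear_Re] bounded_linear_compose[OF bounded_linear_vec_nth]
          bounded_linear_vec_nth)
      have "?h x = 0"
      proof (rule nonneg_set_integral_0_imp_0[of ?h])
        show "continuous_on {0<..} ?h"
          by (intro bounded_linear.continuous_on[OF bl] continuous_on_matrix_mult continuous_on_mat_adjoint
            continuous_on_weight[OF \<mu>_nz \<nu>_pos] continuous_on_subset[OF is_matpoly_continuous_on[OF q]]) auto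
        show "?h x \<ge> 0" if "x > 0" for x
          unfolding diag using t[OF that] by (intro sum_nonneg) (simp add: less_imp_le)
        show "set_integrable lborel {0<..} ?h"
          using integrable_bounded_linear[OF bl] is_matpoly_integrable(1)[OF q q]
          unfolding set_integrable_def by fastforce
        show "(LINT x:{0<..}|lborel. ?h x) = 0"
          using set_integral_bounded_linear[OF bl is_matpoly_integrable(1)[OF q q]] zero by simp
      qed (fact that)
      then have "t k x * (cmod (R x $ i $ k))\<^sup>2 = 0"
        unfolding diag using t[OF that] by (subst (asm) sum_nonneg_eq_0_iff) (auto simp: less_imp_le)
      then show ?thesis
        using t[OF that, of k] by simp
    qed
    then have "q x ** Lmat \<alpha> \<mu> x = 0"
      by (simp add: vec_eq_iff R_def)
    then show ?thesis
      using \<mu>_nz by (rule Lmat_cancel)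
  qed
  \<comment> \<open>The argument above covers x > 0 only; the value at 0 is the limit from the
    right.\<close>
  moreover have "q 0 = 0"
  proof (rule tendsto_unique)
    show "(q \<longlongrightarrow> q 0) (at_right 0)"
    proof (rule tendsto_within_subset)
      show "(q \<longlongrightarrow> q 0) (at 0 within {0..})"
        using is_matpoly_continuous_on[OF q] by (simp add: continuous_on_def)
    qed auto
    show "(q \<longlongrightarrow> 0) (at_right 0)"
      by (rule tendsto_eventually) (auto simp: eventually_at_filter pos)
  qed simp
  ultimately show ?thesis
    using x by (cases "x = 0") auto
qed

lemma eigenvalue_equation:
  assumes P: "monic_MVOPs W P" and x: "x \<ge> 0"
  shows "D (P n) x = Gam \<alpha> \<nu> \<mu> n ** P n x"
proof -
  let ?G = "Gam \<alpha> \<nu> \<mu> n"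
  define q where "q x = D (P n) x - ?G ** P n x" for x
  have monic: "monic_matpoly n (P n)"
    using P by (simp add: monic_MVOPs_def)
  have Pn: "is_matpoly (Suc n) (P n)"
    using monic by (rule monic_is_matpoly)
  have q: "is_matpoly n q"
    unfolding q_def using monic by (rule Dop_monic)
  let ?I = "\<lambda>f g. LINT x:{0<..}|lborel. f x ** W x ** mat_adjoint (g x)"
  have "?I q q = (LINT x:{0<..}|lborel. D (P n) x ** W x ** mat_adjoint (q x)
      - (?G ** P n x) ** W x ** mat_adjoint (q x))"
    by (simp add: q_def[of _] matrix_mult_algebra)
  also have "\<dots> = ?I (D (P n)) q - ?I (\<lambda>x. ?G ** P n x) q"
    by (intro set_integral_diff is_matpoly_integrable[OF is_matpoly_Dop[OF Pn] q]
        is_matpoly_integrable[OF is_matpoly_mult_left[OF Pn] q])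
  also have "?I (D (P n)) q = ?I (P n) (D q)"
    by (intro Dop_symmetric[OF \<mu>_nz \<nu>_pos] is_matpoly_C2[OF Pn] is_matpoly_C2[OF q] admissible_matpoly[OF Pn q])
  \<comment> \<open>D does not raise the degree, so \<open>D q\<close> again has degree less than n
    and is orthogonal to \<open>P n\<close>.\<close>
  also have "\<dots> = 0"
    using orthogonal_lower_degree[OF P is_matpoly_Dop[OF q]] by simp
  also have "?I (\<lambda>x. ?G ** P n x) q = ?G ** ?I (P n) q"
    unfolding matrix_mul_assoc[symmetric]
    by (intro set_integral_bounded_linear bounded_bilinear.bounded_linear_right[OF bounded_bilinear_matrix_mult])
      (use is_matpoly_integrable(1)[OF Pn q] in \<open>simp add: matrix_mul_assoc\<close>)
  also have "?I (P n) q = 0"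
    using orthogonal_lower_degree[OF P q] by simp
  finally have "?I q q = 0"
    by (simp add: matrix_mult_algebra)
  with q have "q x = 0"
    using x by (rule norm_integral_0_imp_0)
  then show ?thesis
    by (simp add: q_def)
qed

end

theorem proposition4p3:
  fixes \<alpha> \<nu> :: real
    and \<mu> \<delta> :: "'n::{finite,linorder} \<Rightarrow> real"
  assumes "\<And>k. \<mu> k \<noteq> 0" and "\<alpha> > 0" and "\<nu> > 0" and "\<And>k. \<delta> k > 0"
  shows "symmetric_wrt (weight \<alpha> \<nu> \<mu> \<delta>) (Dop \<alpha> \<nu> \<mu>) \<and>
    (\<forall>P. monic_MVOPs (weight \<alpha> \<nu> \<mu> \<delta>) P \<longrightarrow>
      (\<forall>n. \<forall>x\<ge>0. Dop \<alpha> \<nu> \<mu> (P n) x = Gam \<alpha> \<nu> \<mu> n ** P n x))"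
  unfolding symmetric_wrt_def
proof (intro conjI allI impI)
  show "(LINT x:{0<..}|lborel. Dop \<alpha> \<nu> \<mu> G x ** weight \<alpha> \<nu> \<mu> \<delta> x ** mat_adjoint (H x))
      = (LINT x:{0<..}|lborel. G x ** weight \<alpha> \<nu> \<mu> \<delta> x ** mat_adjoint (Dop \<alpha> \<nu> \<mu> H x))"
    if "C2 G" "C2 H" "admissible_pair (weight \<alpha> \<nu> \<mu> \<delta>) (Dop \<alpha> \<nu> \<mu>) G H" for G H
    using assms(1,3) that by (rule Dop_symmetric)
  show "Dop \<alpha> \<nu> \<mu> (P n) x = Gam \<alpha> \<nu> \<mu> n ** P n x"
    if "monic_MVOPs (weight \<alpha> \<nu> \<mu> \<delta>) P" "x \<ge> 0" for P n x
    using assms(1,3,4) that by (rule eigenvalue_equation)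
qed

end
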